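(* Let $G$ be a (fork, co-cricket)-free graph. Then either $G$ is claw-free, or $G$ has a homogeneous set, or for every vertex $u$ of $G$, $G[M(u)]$ is perfect.
   Context: All graphs are finite and simple. For a vertex $u$, $M(u)=V(G)\setminus(N(u)\cup\{u\})$. The claw is $K_{1,3}$. The fork is obtained from $K_{1,3}$ by subdividing one edge once. The diamond is $K_4$ minus an edge; the co-cricket is the disjoint union of a diamond and an isolated vertex. $G$ is $H$-free if it has no induced subgraph isomorphic to $H$. A set $S\subseteq V(G)$ is a homogeneous set if $1<|S|<|V(G)|$ and every vertex outside $S$ is adjacent to all or none of $S$. A graph is perfect if every induced subgraph $H$ satisfies $\chi(H)=\omega(H)$. *)

theory Defs
  imports Main
begin

definition simple_graph :: "'a set \<Rightarrow> ('a \<Rightarrow> 'a \<Rightarrow> bool) \<Rightarrow> bool" where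
  "simple_graph V E \<longleftrightarrow> finite V \<and> (\<forall>x y. E x y \<longrightarrow> x \<in> V \<and> y \<in> V)
     \<and> (\<forall>x y. E x y \<longrightarrow> E y x) \<and> (\<forall>x. \<not> E x x)"

definition induced_rel :: "('a \<Rightarrow> 'a \<Rightarrow> bool) \<Rightarrow> 'a set \<Rightarrow> 'a \<Rightarrow> 'a \<Rightarrow> bool" where
  "induced_rel E X = (\<lambda>x y. E x y \<and> x \<in> X \<and> y \<in> X)"

definition contains_induced ::
  "'b set \<Rightarrow> ('b \<Rightarrow> 'b \<Rightarrow> bool) \<Rightarrow> 'a set \<Rightarrow> ('a \<Rightarrow> 'a \<Rightarrow> bool) \<Rightarrow> bool" where
  "contains_induced VH EH V E \<longleftrightarrow>
     (\<exists>f. inj_on f VH \<and> f ` VH \<subseteq> V \<and> (\<forall>x\<in>VH. \<forall>y\<in>VH. E (f x) (f y) \<longleftrightarrow> EH x y))"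

definition H_free ::
  "'b set \<Rightarrow> ('b \<Rightarrow> 'b \<Rightarrow> bool) \<Rightarrow> 'a set \<Rightarrow> ('a \<Rightarrow> 'a \<Rightarrow> bool) \<Rightarrow> bool" where
  "H_free VH EH V E \<longleftrightarrow> \<not> contains_induced VH EH V E"

definition edges_rel :: "nat set set \<Rightarrow> nat \<Rightarrow> nat \<Rightarrow> bool" where
  "edges_rel Es = (\<lambda>x y. x \<noteq> y \<and> {x, y} \<in> Es)"

definition claw_V :: "nat set" where "claw_V = {0,1,2,3}"
definition claw_E :: "nat \<Rightarrow> nat \<Rightarrow> bool" where
  "claw_E = edges_rel {{0,1},{0,2},{0,3}}"

text \<open>Fork: claw (centre 0, leaves 1,2,4) with edge 0-4 subdivided by vertex 3; edges 0-1, 0-2, 0-3, 3-4.\<close>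
definition fork_V :: "nat set" where "fork_V = {0,1,2,3,4}"
definition fork_E :: "nat \<Rightarrow> nat \<Rightarrow> bool" where
  "fork_E = edges_rel {{0,1},{0,2},{0,3},{3,4}}"

text \<open>Co-cricket: diamond (K4 minus edge 2-3 on vertices 0..3) plus isolated vertex 4.\<close>
definition cocricket_V :: "nat set" where "cocricket_V = {0,1,2,3,4}"
definition cocricket_E :: "nat \<Rightarrow> nat \<Rightarrow> bool" where
  "cocricket_E = edges_rel {{0,1},{0,2},{0,3},{1,2},{1,3}}"

definition nonnbrs :: "'a set \<Rightarrow> ('a \<Rightarrow> 'a \<Rightarrow> bool) \<Rightarrow> 'a \<Rightarrow> 'a set" where
  "nonnbrs V E u = {v \<in> V. v \<noteq> u \<and> \<not> E u v}"

definition homogeneous_set :: "'a set \<Rightarrow> ('a \<Rightarrow> 'a \<Rightarrow> bool) \<Rightarrow> 'a set \<Rightarrow> bool" where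
  "homogeneous_set V E S \<longleftrightarrow> S \<subseteq> V \<and> 1 < card S \<and> card S < card V \<and>
     (\<forall>v \<in> V - S. (\<forall>s\<in>S. E v s) \<or> (\<forall>s\<in>S. \<not> E v s))"

definition colorable :: "'a set \<Rightarrow> ('a \<Rightarrow> 'a \<Rightarrow> bool) \<Rightarrow> nat \<Rightarrow> bool" where
  "colorable V E k \<longleftrightarrow> (\<exists>c :: 'a \<Rightarrow> nat. (\<forall>x\<in>V. c x < k) \<and> (\<forall>x\<in>V. \<forall>y\<in>V. E x y \<longrightarrow> c x \<noteq> c y))"

definition chromatic_number :: "'a set \<Rightarrow> ('a \<Rightarrow> 'a \<Rightarrow> bool) \<Rightarrow> nat" where
  "chromatic_number V E = (LEAST k. colorable V E k)"

definition is_clique :: "'a set \<Rightarrow> ('a \<Rightarrow> 'a \<Rightarrow> bool) \<Rightarrow> 'a set \<Rightarrow> bool" where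
  "is_clique V E K \<longleftrightarrow> K \<subseteq> V \<and> (\<forall>x\<in>K. \<forall>y\<in>K. x \<noteq> y \<longrightarrow> E x y)"

definition clique_number :: "'a set \<Rightarrow> ('a \<Rightarrow> 'a \<Rightarrow> bool) \<Rightarrow> nat" where
  "clique_number V E = Max (card ` {K. is_clique V E K})"

definition perfect :: "'a set \<Rightarrow> ('a \<Rightarrow> 'a \<Rightarrow> bool) \<Rightarrow> bool" where
  "perfect V E \<longleftrightarrow> (\<forall>X \<subseteq> V. chromatic_number X (induced_rel E X) = clique_number X (induced_rel E X))"

end

theory Submission
  imports Defs
begin

text \<open>
  In a co-cricket-free graph every \<open>G[M(u)]\<close> is diamond-free. A fork-free, diamond-free graph without
  odd holes is perfect: a vertex that is not the centre of a claw has as neighbourhood two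
  anticomplete cliques, and a Kempe chain argument extends a colouring to it; if all vertices are
  centres of claws, the graph is triangle-free and each component is bipartite of radius at most three.

  It remains to see that an odd hole \<open>C\<close> in some \<open>M(u)\<close> forces a graph without homogeneous sets to be
  claw-free. No vertex is complete to \<open>C\<close>, and every other vertex with a neighbour on \<open>C\<close> attaches
  along one or two disjoint edges of \<open>C\<close>; the vertices attached to a given edge form a clique, and
  those attached to consecutive edges are anticomplete. So near \<open>C\<close> the graph looks like a line
  graph and all neighbourhoods are covered by two cliques. For the remaining vertices a claw is pulled
  towards \<open>C\<close> along a shortest path.
\<close>

section \<open>Colouring graphs without odd holes\<close>

locale graph =
  fixes V :: "'a set" and E :: "'a \<Rightarrow> 'a \<Rightarrow> bool"
  assumes graph: "simple_graph V E"
begin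

lemma finite_V: "finite V"
  and sym: "E x y \<Longrightarrow> E y x"
  and irrefl: "\<not> E x x"
  and in_V: "E x y \<Longrightarrow> x \<in> V" "E x y \<Longrightarrow> y \<in> V"
  using graph unfolding simple_graph_def by blast+

lemma commute: "E x y \<longleftrightarrow> E y x"
  using sym by blast

definition claw_at :: "'a \<Rightarrow> 'a \<Rightarrow> 'a \<Rightarrow> 'a \<Rightarrow> bool" where
  "claw_at x p q r \<longleftrightarrow> E x p \<and> E x q \<and> E x r \<and> p \<noteq> q \<and> p \<noteq> r \<and> q \<noteq> r
     \<and> \<not> E p q \<and> \<not> E p r \<and> \<not> E q r"

lemma claw_at_rotate: "claw_at x p q r \<longleftrightarrow> claw_at x q r p"
  and claw_at_swap: "claw_at x p q r \<longleftrightarrow> claw_at x q p r"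
  using commute[of p q] commute[of p r] commute[of q r] unfolding claw_at_def by auto

text \<open>Two of the three leaves fall into the same clique.\<close>

lemma not_claw_at_if_two_cliques:
  assumes "\<And>y. E x y \<Longrightarrow> y \<in> A \<or> y \<in> B"
    and "\<And>y z. y \<in> A \<Longrightarrow> z \<in> A \<Longrightarrow> y \<noteq> z \<Longrightarrow> E y z"
    and "\<And>y z. y \<in> B \<Longrightarrow> z \<in> B \<Longrightarrow> y \<noteq> z \<Longrightarrow> E y z"
  shows "\<not> claw_at x p q r"
  using assms unfolding claw_at_def by metis

end

section \<open>Odd holes as periodic sequences\<close>

definition odd_hole :: "('a \<Rightarrow> 'a \<Rightarrow> bool) \<Rightarrow> (int \<Rightarrow> 'a) \<Rightarrow> int \<Rightarrow> bool" where
  "odd_hole E c n \<longleftrightarrow> odd n \<and> 5 \<le> n \<and> (\<forall>i j. c i = c j \<longleftrightarrow> n dvd i - j)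
     \<and> (\<forall>i j. E (c i) (c j) \<longleftrightarrow> n dvd i - j - 1 \<or> n dvd i - j + 1)"

text \<open>Turns a cycle listed by an initial segment of the naturals, as path arguments produce
  it, into the periodic form.\<close>

lemma odd_hole_of_fun:
  fixes g :: "nat \<Rightarrow> 'a" and m :: nat
  assumes sym: "\<And>x y. E x y \<Longrightarrow> E y x" and irrefl: "\<And>x. \<not> E x x"
    and m: "odd m" "5 \<le> m"
    and inj: "inj_on g {..<m}"
    and adj: "\<And>i j. i < j \<Longrightarrow> j < m \<Longrightarrow> E (g i) (g j) \<longleftrightarrow> j = Suc i \<or> i = 0 \<and> j = m - 1"
  shows "odd_hole E (\<lambda>i. g (nat (i mod int m))) (int m)"
proof -
  let ?n = "int m"
  let ?r = "\<lambda>i. nat (i mod ?n)"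
  have lt: "?r i < m" for i
    using m by (simp add: nat_less_iff)
  \<comment> \<open>Applied to differences of reduced indices, where divisibility leaves only the
    value 0; the wrap-around pair \<open>0\<close>, \<open>m - 1\<close> is the one exception and is
    treated by itself.\<close>
  have dvd0: "?n dvd k \<longleftrightarrow> k = 0" if "\<bar>k\<bar> < ?n" for k :: int
    using that zdvd_imp_le[of ?n "\<bar>k\<bar>"] by (cases "k = 0") auto
  have dvd_r: "?n dvd i - j + k \<longleftrightarrow> ?n dvd int (?r i) - int (?r j) + k" for i j k :: int
  proof -
    have "int (?r i) = i - ?n * (i div ?n)" "int (?r j) = j - ?n * (j div ?n)"
      using m by (simp_all add: minus_mult_div_eq_mod)
    then have "int (?r i) - int (?r j) + k = (i - j + k) + ?n * (j div ?n - i div ?n)"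
      by (simp add: algebra_simps)
    then show ?thesis
      by (metis dvd_add_times_triv_right_iff mult.commute)
  qed
  have "g (?r i) = g (?r j) \<longleftrightarrow> ?n dvd i - j" for i j
  proof -
    have "g (?r i) = g (?r j) \<longleftrightarrow> ?r i = ?r j"
      using inj lt by (auto simp: inj_on_def)
    also have "\<dots> \<longleftrightarrow> ?n dvd int (?r i) - int (?r j) + 0"
    proof -
      have "a = b \<longleftrightarrow> ?n dvd int a - int b + 0" if "a < m" "b < m" for a b
        using dvd0[of "int a - int b"] that by simp
      then show ?thesis using lt by blast
    qed
    finally show ?thesis
      using dvd_r[of i j 0] by simp
  qed
  moreover have "E (g (?r i)) (g (?r j)) \<longleftrightarrow> ?n dvd i - j - 1 \<or> ?n dvd i - j + 1" for i j
  proof -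
    have *: "E (g a) (g b) \<longleftrightarrow> ?n dvd int a - int b + (-1) \<or> ?n dvd int a - int b + 1"
      if "a < b" "b < m" for a b
    proof -
      have "?n dvd int a - int b + (-1) \<longleftrightarrow> a = 0 \<and> b = m - 1"
      proof (cases "a = 0 \<and> b = m - 1")
        case False
        then show ?thesis
          using that dvd0[of "int a - int b + (-1)"] by linarith
      next
        case True
        then have "int a - int b + (-1) = - ?n" using that by auto
        then show ?thesis using True by simp
      qed
      moreover have "?n dvd int a - int b + 1 \<longleftrightarrow> b = Suc a"
        using that dvd0[of "int a - int b + 1"] by auto
      ultimately show ?thesis
        using adj[OF that] by auto
    qed
    have neg: "?n dvd int b - int a + (-1) \<longleftrightarrow> ?n dvd int a - int b + 1"
      "?n dvd int b - int a + 1 \<longleftrightarrow> ?n dvd int a - int b + (-1)" for a b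
      using dvd_minus_iff[of ?n "int a - int b + 1"] dvd_minus_iff[of ?n "int a - int b + (-1)"]
      by (simp_all add: algebra_simps)
    have "E (g (?r i)) (g (?r j))
      \<longleftrightarrow> ?n dvd int (?r i) - int (?r j) + (-1) \<or> ?n dvd int (?r i) - int (?r j) + 1"
    proof (cases "?r i" "?r j" rule: linorder_cases)
      case less
      then show ?thesis using * lt by blast
    next
      case equal
      then show ?thesis using irrefl m dvd0[of 1] by simp
    next
      case greater
      then show ?thesis using *[OF greater lt] neg sym by blast
    qed
    then show ?thesis
      using dvd_r[of i j "-1"] dvd_r[of i j 1] by simp
  qed
  ultimately show ?thesis
    using m unfolding odd_hole_def by simp
qed

section \<open>Kempe chains at a vertex whose neighbourhood is two cliques\<close>

context graph
begin

text \<open>Kempe chain argument: if the \<open>\<alpha>\<close>-\<open>\<beta>\<close>-component of \<open>p\<close> contains \<open>q\<close>, then a shortest path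
  from \<open>p\<close> to \<open>q\<close> in it closes up to an odd hole through \<open>v\<close>.\<close>

lemma colorable_insert_two_cliques:
  assumes X: "X \<subseteq> V" and v: "v \<in> X"
    and col: "colorable (X - {v}) E w"
    and w: "\<And>K. is_clique X E K \<Longrightarrow> card K \<le> w"
    and cover: "{y \<in> X. E v y} = K1 \<union> K2"
    and K1: "\<And>y z. y \<in> K1 \<Longrightarrow> z \<in> K1 \<Longrightarrow> y \<noteq> z \<Longrightarrow> E y z"
    and K2: "\<And>y z. y \<in> K2 \<Longrightarrow> z \<in> K2 \<Longrightarrow> y \<noteq> z \<Longrightarrow> E y z"
    and anti: "\<And>y z. y \<in> K1 \<Longrightarrow> z \<in> K2 \<Longrightarrow> \<not> E y z" "K1 \<inter> K2 = {}"
    and no_hole: "\<nexists>c n. odd_hole E c n \<and> range c \<subseteq> X"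
  shows "colorable X E w"
proof -
  obtain \<kappa> :: "'a \<Rightarrow> nat" where \<kappa>w: "\<And>x. x \<in> X - {v} \<Longrightarrow> \<kappa> x < w"
    and \<kappa>: "\<And>x y. x \<in> X - {v} \<Longrightarrow> y \<in> X - {v} \<Longrightarrow> E x y \<Longrightarrow> \<kappa> x \<noteq> \<kappa> y"
    using col unfolding colorable_def by blast
  have finX: "finite X"
    using X finite_V finite_subset by blast
  have extend: "colorable X E w"
    if \<kappa>': "\<And>x. x \<in> X - {v} \<Longrightarrow> \<kappa>' x < w"
      "\<And>x y. x \<in> X - {v} \<Longrightarrow> y \<in> X - {v} \<Longrightarrow> E x y \<Longrightarrow> \<kappa>' x \<noteq> \<kappa>' y"
      and g: "\<gamma> < w" "\<And>y. y \<in> K1 \<union> K2 \<Longrightarrow> \<kappa>' y \<noteq> \<gamma>" for \<kappa>' \<gamma>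
  proof -
    have "\<kappa>' y \<noteq> \<gamma>" if "y \<in> X" "E v y \<or> E y v" for y
      using g(2) cover that sym by blast
    then show ?thesis
      unfolding colorable_def
      by (intro exI[of _ "\<kappa>'(v := \<gamma>)"]) (use \<kappa>' g(1) irrefl in \<open>auto simp: fun_upd_def\<close>)
  qed
  \<comment> \<open>Together with \<open>v\<close>, the set \<open>K\<close> is a clique of at most
    \<open>w\<close> vertices, so \<open>K\<close> alone cannot use up \<open>w\<close>
    colours.\<close>
  have missing: "\<exists>\<alpha><w. \<forall>y\<in>K. \<kappa> y \<noteq> \<alpha>"
    if K: "K \<subseteq> {y \<in> X. E v y}" "\<And>y z. y \<in> K \<Longrightarrow> z \<in> K \<Longrightarrow> y \<noteq> z \<Longrightarrow> E y z" for K
  proof -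
    have "is_clique X E (insert v K)"
      using K v sym unfolding is_clique_def by blast
    moreover have "finite K" "v \<notin> K"
      using K(1) finX irrefl by (auto intro: rev_finite_subset)
    ultimately have "card K < w"
      using w[of "insert v K"] by simp
    then have "card (\<kappa> ` K) < card {..<w}"
      using card_image_le[OF \<open>finite K\<close>, of \<kappa>] by simp
    then have "\<not> {..<w} \<subseteq> \<kappa> ` K"
      using \<open>finite K\<close> by (meson card_mono finite_imageI leD)
    then show ?thesis by fastforce
  qed
  obtain \<alpha> where \<alpha>: "\<alpha> < w" "\<And>y. y \<in> K1 \<Longrightarrow> \<kappa> y \<noteq> \<alpha>"
    using missing[of K1] K1 cover by blast
  obtain \<beta> where \<beta>: "\<beta> < w" "\<And>y. y \<in> K2 \<Longrightarrow> \<kappa> y \<noteq> \<beta>"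
    using missing[of K2] K2 cover by blast
  show ?thesis
  proof (cases "\<exists>\<gamma><w. \<forall>y\<in>K1 \<union> K2. \<kappa> y \<noteq> \<gamma>")
    case True
    then show ?thesis using extend \<kappa>w \<kappa> by blast
  next
    case False
    \<comment> \<open>No colour is free at \<open>v\<close>: \<beta> is free on \<open>K2\<close>,
      hence occurs on \<open>K1\<close>, and likewise \<alpha> occurs on \<open>K2\<close>. Cliques
      repeat no colour, so \<open>p\<close> and \<open>q\<close> are unique.\<close>
    then obtain p q where p: "p \<in> K1" "\<kappa> p = \<beta>" and q: "q \<in> K2" "\<kappa> q = \<alpha>"
      using \<alpha> \<beta> by blast
    have ab: "\<alpha> \<noteq> \<beta>" using \<alpha> p by blast
    have sub: "K1 \<union> K2 \<subseteq> X - {v}" using cover irrefl by blast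
    have pu: "y = p" if "y \<in> K1" "\<kappa> y = \<beta>" for y
      using K1[OF that(1) p(1)] \<kappa>[of y p] that p subsetD[OF sub] by (metis UnCI)
    have qu: "y = q" if "y \<in> K2" "\<kappa> y = \<alpha>" for y
      using K2[OF that(1) q(1)] \<kappa>[of y q] that q subsetD[OF sub] by (metis UnCI)
    define Y where "Y = {y \<in> X - {v}. \<kappa> y = \<alpha> \<or> \<kappa> y = \<beta>}"
    define R where "R = {(y, z). y \<in> Y \<and> z \<in> Y \<and> E y z}"
    have pY: "p \<in> Y" and qY: "q \<in> Y" using p q sub unfolding Y_def by auto
    show ?thesis
    proof (cases "(p, q) \<in> R\<^sup>*")
      case False
      define P where "P = {y. (p, y) \<in> R\<^sup>*}"
      have PY: "y \<in> Y" if "y \<in> P" for y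
        using that pY unfolding P_def by (auto elim: rtranclE simp: R_def)
      have closed: "z \<in> P" if "y \<in> P" "z \<in> Y" "E y z" for y z
        using that PY[of y] unfolding P_def R_def by (auto intro: rtrancl_into_rtrancl)
      \<comment> \<open>Swapping the two colours on the component of \<open>p\<close> gives
        \<open>p\<close> the colour \<alpha> and leaves \<open>q\<close> alone, so \<beta> becomes
        free at \<open>v\<close>.\<close>
      define \<kappa>' where "\<kappa>' y = (if y \<in> P then if \<kappa> y = \<alpha> then \<beta> else \<alpha> else \<kappa> y)" for y
      show ?thesis
      proof (rule extend[of \<kappa>' \<beta>])
        show "\<kappa>' x < w" if "x \<in> X - {v}" for x
          using \<kappa>w[OF that] \<alpha> \<beta> unfolding \<kappa>'_def by simp
        show "\<kappa>' x \<noteq> \<kappa>' y" if "x \<in> X - {v}" "y \<in> X - {v}" "E x y" for x y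
        proof -
          have "x \<in> Y \<longleftrightarrow> \<kappa> x = \<alpha> \<or> \<kappa> x = \<beta>" "y \<in> Y \<longleftrightarrow> \<kappa> y = \<alpha> \<or> \<kappa> y = \<beta>"
            using that unfolding Y_def by simp_all
          moreover have "x \<in> P \<longleftrightarrow> y \<in> P" if "x \<in> Y" "y \<in> Y"
            using closed[of x y] closed[of y x] that \<open>E x y\<close> sym by metis
          moreover have "\<kappa> x \<noteq> \<kappa> y" by (rule \<kappa>[OF that])
          ultimately show ?thesis
            using PY[of x] PY[of y] ab unfolding \<kappa>'_def by metis
        qed
        show "\<beta> < w" by fact
        show "\<kappa>' y \<noteq> \<beta>" if "y \<in> K1 \<union> K2" for y
        proof (cases "y \<in> K1")
          case True
          have "p \<in> P" unfolding P_def by simp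
          then show ?thesis
            using pu[OF True] \<alpha>(2)[OF True] ab p unfolding \<kappa>'_def by auto
        next
          case f: False
          then have "y \<in> K2" using that by blast
          then show ?thesis
            using qu[of y] \<beta>(2)[of y] False PY[of y] unfolding \<kappa>'_def P_def Y_def by auto
        qed
      qed
    next
      case True
      \<comment> \<open>A path of least length has no chords, which makes the cycle through
        \<open>v\<close> induced.\<close>
      define m where "m = (LEAST m. (p, q) \<in> R ^^ m)"
      have "(p, q) \<in> R ^^ m"
        unfolding m_def using True by (metis LeastI_ex rtrancl_imp_relpow)
      then obtain f where f0: "f 0 = p" and fm: "f m = q"
        and f: "\<And>i. i < m \<Longrightarrow> (f i, f (Suc i)) \<in> R"
        unfolding relpow_fun_conv by blast
      have least: "m \<le> k" if "(p, q) \<in> R ^^ k" for k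
        unfolding m_def using that by (rule Least_le)
      have seg: "(f i, f (i + k)) \<in> R ^^ k" if "i + k \<le> m" for i k
        using that
      proof (induction k)
        case (Suc k)
        then show ?case using f[of "i + k"] by auto
      qed simp
      have fY: "f i \<in> Y" if "i \<le> m" for i
      proof (cases "i = m")
        case True
        then show ?thesis using fm qY by simp
      next
        case False
        then show ?thesis using f[of i] that unfolding R_def by simp
      qed
      have short: "j = Suc i" if "i < j" "j \<le> m" "E (f i) (f j)" for i j
      proof -
        have "(f i, f j) \<in> R" using fY that unfolding R_def by simp
        then have "(p, f j) \<in> R ^^ Suc i"
          using seg[of 0 i] that f0 by auto
        then have "(p, q) \<in> R ^^ (Suc i + (m - j))"
          using seg[of j "m - j"] that fm unfolding relpow_add by auto
        then show ?thesis using least that by fastforce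
      qed
      have inj: "f i \<noteq> f j" if "i < j" "j \<le> m" for i j
      proof
        assume "f i = f j"
        then have "(p, q) \<in> R ^^ (i + (m - j))"
          using seg[of 0 i] seg[of j "m - j"] that f0 fm unfolding relpow_add by auto
        then show False using least that by fastforce
      qed
      have alt: "\<kappa> (f i) = (if even i then \<beta> else \<alpha>)" if "i \<le> m" for i
        using that
      proof (induction i)
        case 0
        then show ?case using f0 p by simp
      next
        case (Suc i)
        then have "(f i, f (Suc i)) \<in> R" using f by simp
        then have "\<kappa> (f i) \<noteq> \<kappa> (f (Suc i))" "f (Suc i) \<in> Y"
          using \<kappa> unfolding R_def Y_def by auto
        then show ?case using Suc unfolding Y_def by auto
      qed
      \<comment> \<open>The colours alternate and differ at the two ends, so \<open>m\<close> is
        odd, and \<open>v\<close> closes the path to an odd cycle of \<open>m + 2\<close>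
        vertices.\<close>
      have odd: "odd m" using alt[of m] fm q ab by (auto split: if_splits)
      have "\<not> E p q" using anti p q by blast
      then have "m \<noteq> 1" using f[of 0] f0 fm unfolding R_def by auto
      then have m3: "3 \<le> m" using odd by presburger
      have vadj: "E v (f i) \<longleftrightarrow> i = 0 \<or> i = m" if "i \<le> m" for i
      proof
        assume "E v (f i)"
        then have "f i \<in> K1 \<union> K2" using fY[OF that] cover unfolding Y_def by blast
        then have "f i = p \<or> f i = q"
          using pu[of "f i"] qu[of "f i"] \<alpha>(2)[of "f i"] \<beta>(2)[of "f i"] alt[OF that]
          by (auto split: if_splits)
        then show "i = 0 \<or> i = m"
          using inj[of 0 i] inj[of i m] f0 fm that by force
      next
        assume "i = 0 \<or> i = m"
        then show "E v (f i)" using f0 fm p q cover by blast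
      qed
      define g where "g i = (if i \<le> m then f i else v)" for i
      have gX: "g i \<in> X" for i
        using fY[of i] v unfolding g_def Y_def by auto
      have "odd_hole E (\<lambda>i. g (nat (i mod int (m + 2)))) (int (m + 2))"
      proof (rule odd_hole_of_fun)
        show "inj_on g {..<m + 2}"
        proof (rule linorder_inj_onI)
          fix i j assume "i < j" "i \<in> {..<m + 2}" "j \<in> {..<m + 2}"
          then show "g i \<noteq> g j"
            using inj[of i j] fY[of i] unfolding g_def Y_def by auto
        qed auto
        show "E (g i) (g j) \<longleftrightarrow> j = Suc i \<or> i = 0 \<and> j = m + 2 - 1"
          if "i < j" "j < m + 2" for i j
        proof (cases "j \<le> m")
          case True
          then show ?thesis
            using short[of i j] f[of i] that unfolding g_def R_def by auto
        next
          case False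
          then have "j = Suc m" using that by simp
          then show ?thesis
            using vadj[of i] that m3 unfolding g_def by (auto simp: commute[of _ v])
        qed
        show "odd (m + 2)" "5 \<le> m + 2" using odd m3 by auto
      qed (use sym irrefl in auto)
      then show ?thesis using no_hole gX by blast
    qed
  qed
qed

end

section \<open>Perfection of fork-free graphs without diamonds and odd holes\<close>

locale fork_free_graph = graph +
  assumes fork_free: "H_free fork_V fork_E V E"
begin

text \<open>The centre is \<open>x\<close>, its leaves are \<open>a\<close> and \<open>b\<close>,
  and \<open>p\<close>, \<open>q\<close> form the subdivided branch. Only \<open>a\<close> and
  \<open>b\<close> are twins in a fork; all other pairs are told apart by adjacency, so one
  inequality suffices.\<close>

lemma no_fork:
  assumes "E x a" "E x b" "E x p" "E p q" "a \<noteq> b"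
    and "\<not> E a b" "\<not> E a p" "\<not> E b p" "\<not> E x q" "\<not> E a q" "\<not> E b q"
  shows False
proof -
  define f :: "nat \<Rightarrow> 'a" where
    "f k = (if k = 0 then x else if k = 1 then a else if k = 2 then b else if k = 3 then p else q)" for k
  have "x \<noteq> a" "x \<noteq> b" "x \<noteq> p" "x \<noteq> q" "a \<noteq> p" "a \<noteq> q" "b \<noteq> p" "b \<noteq> q" "p \<noteq> q"
    using assms irrefl sym by metis+
  moreover have "E a x" "E b x" "E p x" "E q p" "\<not> E b a" "\<not> E p a" "\<not> E p b"
    "\<not> E q x" "\<not> E q a" "\<not> E q b"
    using assms sym by metis+
  moreover have "x \<in> V" "a \<in> V" "b \<in> V" "p \<in> V" "q \<in> V"
    using assms in_V by metis+
  ultimately have "inj_on f fork_V \<and> f ` fork_V \<subseteq> V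
    \<and> (\<forall>y\<in>fork_V. \<forall>z\<in>fork_V. E (f y) (f z) \<longleftrightarrow> fork_E y z)"
    using assms irrefl
    unfolding f_def fork_V_def fork_E_def edges_rel_def inj_on_def
    by (simp add: doubleton_eq_iff)
  then show False
    using fork_free unfolding H_free_def contains_induced_def by blast
qed

text \<open>Here every vertex of \<open>X\<close> is the centre of a claw, so for each vertex of a triangle there are two
  further neighbours off the triangle; fork-freeness links these pairs too densely.\<close>

lemma no_triangle_if_claws_everywhere:
  assumes X: "X \<subseteq> V"
    and dia: "\<And>x y s t. x \<in> X \<Longrightarrow> y \<in> X \<Longrightarrow> s \<in> X \<Longrightarrow> t \<in> X \<Longrightarrow> E x y \<Longrightarrow> E x s \<Longrightarrow> E x t \<Longrightarrow> E y s \<Longrightarrow> E y t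
      \<Longrightarrow> s \<noteq> t \<Longrightarrow> E s t"
    and claws: "\<And>x. x \<in> X \<Longrightarrow> \<exists>p\<in>X. \<exists>q\<in>X. \<exists>r\<in>X. claw_at x p q r"
    and T: "x \<in> X" "y \<in> X" "z \<in> X" "E x y" "E x z" "E y z"
  shows False
proof -
  \<comment> \<open>Diamond-freeness lets at most one leaf of a claw at \<open>x\<close> be
    \<open>y\<close> or a neighbour of \<open>y\<close>, and a leaf that is neither misses
    \<open>z\<close> too; so two leaves avoid the triangle.\<close>
  have pair: "\<exists>b\<in>X. \<exists>c\<in>X. E x b \<and> E x c \<and> b \<noteq> c \<and> \<not> E b c
      \<and> \<not> E b y \<and> \<not> E c y \<and> \<not> E b z \<and> \<not> E c z"
    if T: "x \<in> X" "y \<in> X" "z \<in> X" "E x y" "E x z" "E y z" for x y z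
  proof -
    obtain p q r where C: "p \<in> X" "q \<in> X" "r \<in> X" "claw_at x p q r"
      using claws T by blast
    have side: "\<not> E t z \<and> t \<noteq> y" if "t \<in> X" "E x t" "\<not> E t y" "t \<noteq> y" for t
      using dia[of x z t y] that T sym by metis
    have one: "\<not> ((s = y \<or> E s y) \<and> (t = y \<or> E t y))"
      if "s \<in> X" "t \<in> X" "E x s" "E x t" "s \<noteq> t" "\<not> E s t" for s t
      using dia[of x y s t] that T sym by metis
    consider "\<not> E p y" "p \<noteq> y" "\<not> E q y" "q \<noteq> y" | "\<not> E p y" "p \<noteq> y" "\<not> E r y" "r \<noteq> y"
      | "\<not> E q y" "q \<noteq> y" "\<not> E r y" "r \<noteq> y"
      using one[of p q] one[of p r] one[of q r] C unfolding claw_at_def by blast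
    then show ?thesis
      using side[of p] side[of q] side[of r] C unfolding claw_at_def by cases metis+
  qed
  \<comment> \<open>A fork at \<open>x\<close> with branch \<open>y\<close>, \<open>d\<close> puts
    \<open>d\<close> next to \<open>b\<close> or \<open>c\<close>; a fork at \<open>x\<close> with
    leaf \<open>z\<close> then gives the other one as well.\<close>
  have far: "E d b \<and> E d c \<and> \<not> E d z"
    if T: "x \<in> X" "y \<in> X" "z \<in> X" "E x y" "E x z" "E y z"
      and bc: "b \<in> X" "c \<in> X" "E x b" "E x c" "b \<noteq> c" "\<not> E b c"
        "\<not> E b y" "\<not> E c y" "\<not> E b z" "\<not> E c z"
      and d: "d \<in> X" "E d y" "\<not> E d x" "d \<noteq> x" for x y z b c d
  proof -
    have nz: "\<not> E d z"
      using dia[of y z d x] T d sym by metis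
    have "E d b \<or> E d c"
      using no_fork[of x b c y d] T bc d sym by metis
    moreover have "E d c" if "E d b"
      using no_fork[of x z c b d] that T bc d nz sym irrefl by metis
    moreover have "E d b" if "E d c"
      using no_fork[of x z b c d] that T bc d nz sym irrefl by metis
    ultimately show ?thesis using nz by blast
  qed
  have T': "E y x" "E z x" "E z y"
    using T sym by auto
  obtain b c where bc: "b \<in> X" "c \<in> X" "E x b" "E x c" "b \<noteq> c" "\<not> E b c"
      "\<not> E b y" "\<not> E c y" "\<not> E b z" "\<not> E c z"
    using pair[OF T] by blast
  obtain e where e: "e \<in> X" "E y e" "\<not> E e x" "\<not> E e z"
    using pair[of y x z] T T' by blast
  obtain d d' where d: "d \<in> X" "d' \<in> X" "E z d" "E z d'" "d \<noteq> d'" "\<not> E d d'"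
      "\<not> E d x" "\<not> E d' x" "\<not> E d y" "\<not> E d' y"
    using pair[of z x y] T T' by blast
  have "E e b" "E e c"
    using far[of x y z b c e] T bc e T' sym by metis+
  moreover have "E d b" "E d c"
    using far[of x z y b c d] T bc d T' sym by metis+
  moreover have "E e d"
    using far[of z y x d d' e] T T' d e sym by metis
  \<comment> \<open>Now \<open>d\<close> and \<open>e\<close> are adjacent and have the nonadjacent
    common neighbours \<open>b\<close> and \<open>c\<close>.\<close>
  ultimately show False
    using dia[of d e b c] bc d e sym by metis
qed

text \<open>The layers \<open>N\<close>, \<open>D\<close>, \<open>F\<close> around \<open>x\<close>
  are independent and there is no fourth layer, so the component \<open>S\<close> of
  \<open>x\<close> is bipartite. Two colours do for it, and \<open>IH\<close> colours the
  rest.\<close>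

lemma colorable_if_claws_everywhere:
  assumes X: "X \<subseteq> V" "X \<noteq> {}"
    and tri: "\<And>x y z. x \<in> X \<Longrightarrow> y \<in> X \<Longrightarrow> z \<in> X \<Longrightarrow> E x y \<Longrightarrow> E x z \<Longrightarrow> \<not> E y z"
    and claws: "\<And>x. x \<in> X \<Longrightarrow> \<exists>p\<in>X. \<exists>q\<in>X. \<exists>r\<in>X. claw_at x p q r"
    and IH: "\<And>Y. Y \<subset> X \<Longrightarrow> colorable Y E w"
    and w: "2 \<le> w"
  shows "colorable X E w"
proof -
  obtain x where x: "x \<in> X" using X by blast
  define N where "N = {y \<in> X. E x y}"
  define D where "D = {d \<in> X. d \<noteq> x \<and> d \<notin> N \<and> (\<exists>b\<in>N. E b d)}"
  define F where "F = {e \<in> X. e \<noteq> x \<and> e \<notin> N \<and> e \<notin> D \<and> (\<exists>d\<in>D. E d e)}"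
  obtain p q r where pqr: "p \<in> N" "q \<in> N" "r \<in> N" "p \<noteq> q" "p \<noteq> r" "q \<noteq> r"
    using claws[OF x] unfolding claw_at_def N_def by blast
  have tri': "\<not> E y z" if "y \<in> X" "z \<in> X" "u \<in> X" "E u y" "E u z" for u y z
    using tri[of u y z] that by simp
  have N: "\<not> E y z" if "y \<in> N" "z \<in> N" for y z
    using tri'[of y z x] that x unfolding N_def by simp
  \<comment> \<open>A vertex \<open>d\<close> missing two vertices of \<open>N\<close> would end a
    fork centred at \<open>x\<close>.\<close>
  have two: "E d a \<or> E d c" if "d \<in> D" "a \<in> N" "c \<in> N" "a \<noteq> c" for a c d
  proof -
    obtain b where b: "b \<in> N" "E b d" using \<open>d \<in> D\<close> unfolding D_def by blast
    show ?thesis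
      using no_fork[of x a c b d] b that N[of a c] N[of a b] N[of c b] sym[of d a] sym[of d c]
      unfolding N_def D_def by (auto simp: commute[of d])
  qed
  have most: "E d p \<and> E d q \<or> E d p \<and> E d r \<or> E d q \<and> E d r" if "d \<in> D" for d
    using two[OF that, of p q] two[OF that, of p r] two[OF that, of q r] pqr by argo
  \<comment> \<open>Both ends see two of \<open>p\<close>, \<open>q\<close>, \<open>r\<close>, hence
    share one of them, and an edge would close a triangle.\<close>
  have D: "\<not> E d d'" if "d \<in> D" "d' \<in> D" for d d'
  proof
    assume "E d d'"
    obtain b where "b \<in> N" "E d b" "E d' b"
      using most[OF \<open>d \<in> D\<close>] most[OF \<open>d' \<in> D\<close>] pqr(1-3) by blast
    then show False
      using tri'[of d d' b] that \<open>E d d'\<close> sym unfolding D_def N_def by auto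
  qed
  \<comment> \<open>An edge from \<open>F\<close> that stays in \<open>F\<close> or leaves the
    layers would end a fork centred at \<open>d\<close>, with two neighbours of \<open>d\<close> in
    \<open>N\<close> as leaves.\<close>
  have F: "f \<in> insert x (N \<union> D)" if "e \<in> F" "f \<in> X" "E e f" for e f
  proof (rule ccontr)
    assume f: "f \<notin> insert x (N \<union> D)"
    obtain d where d: "d \<in> D" "E d e" using \<open>e \<in> F\<close> unfolding F_def by blast
    obtain b b' where b: "b \<in> N" "b' \<in> N" "b \<noteq> b'" "E d b" "E d b'"
      using most[OF d(1)] pqr by blast
    have X': "d \<in> X" "e \<in> X" "b \<in> X" "b' \<in> X" using d b \<open>e \<in> F\<close> unfolding D_def F_def N_def by auto
    have "\<not> E b e" "\<not> E b' e" using b \<open>e \<in> F\<close> unfolding F_def D_def by blast+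
    moreover have "\<not> E b f" "\<not> E b' f" using b f that unfolding D_def by blast+
    moreover have "\<not> E d f" using tri'[of d f e] X' that d sym by metis
    ultimately show False
      using no_fork[of d b b' e f] d b that N[of b b'] by blast
  qed
  define S where "S = insert x (N \<union> D \<union> F)"
  have SX: "S \<subseteq> X" using x unfolding S_def N_def D_def F_def by blast
  have closed: "z \<in> S" if "y \<in> S" "z \<in> X" "E y z" for y z
  proof (cases "y \<in> F")
    case True
    then show ?thesis using F[of y z] that unfolding S_def by blast
  next
    case False
    then show ?thesis using that unfolding S_def N_def D_def F_def by blast
  qed
  have "X - S \<subset> X" using x SX unfolding S_def by blast
  then have "colorable (X - S) E w" by (rule IH)
  then obtain \<kappa> :: "'a \<Rightarrow> nat" where \<kappa>: "\<And>y. y \<in> X - S \<Longrightarrow> \<kappa> y < w"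
    "\<And>y z. y \<in> X - S \<Longrightarrow> z \<in> X - S \<Longrightarrow> E y z \<Longrightarrow> \<kappa> y \<noteq> \<kappa> z"
    unfolding colorable_def by blast
  have cross: "y \<in> insert x D \<longleftrightarrow> z \<in> N \<union> F" if "y \<in> S" "z \<in> S" "E y z" for y z
  proof -
    have disj: "insert x D \<inter> (N \<union> F) = {}"
      using irrefl unfolding N_def D_def F_def by blast
    have "\<not> E x d" if "d \<in> insert x D" for d using that irrefl unfolding D_def N_def by blast
    then have "\<not> (y \<in> insert x D \<and> z \<in> insert x D)" using D that commute by blast
    moreover have "\<not> (y \<in> N \<union> F \<and> z \<in> N \<union> F)"
      using N[of y z] F[of y z] F[of z y] that SX sym disj unfolding F_def D_def by blast
    ultimately show ?thesis using that unfolding S_def by blast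
  qed
  have disj: "y \<notin> N \<union> F" if "y \<in> insert x D" for y
    using that irrefl unfolding N_def D_def F_def by blast
  have parts: "y \<in> insert x D \<or> y \<in> N \<union> F" if "y \<in> S" for y
    using that unfolding S_def by blast
  have "colorable S E 2"
    unfolding colorable_def
    by (intro exI[of _ "\<lambda>y. if y \<in> insert x D then 0 else 1"]) (use cross disj parts in auto)
  then obtain \<mu> :: "'a \<Rightarrow> nat" where \<mu>: "\<And>y. y \<in> S \<Longrightarrow> \<mu> y < 2"
    "\<And>y z. y \<in> S \<Longrightarrow> z \<in> S \<Longrightarrow> E y z \<Longrightarrow> \<mu> y \<noteq> \<mu> z"
    unfolding colorable_def by blast
  show ?thesis
    unfolding colorable_def
  proof (intro exI[of _ "\<lambda>y. if y \<in> S then \<mu> y else \<kappa> y"] conjI ballI impI)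
    show "(if y \<in> S then \<mu> y else \<kappa> y) < w" if "y \<in> X" for y
      using \<mu>(1)[of y] \<kappa>(1)[of y] that w by auto
    show "(if y \<in> S then \<mu> y else \<kappa> y) \<noteq> (if z \<in> S then \<mu> z else \<kappa> z)"
      if "y \<in> X" "z \<in> X" "E y z" for y z
      using \<mu>(2)[of y z] \<kappa>(2)[of y z] closed[of y z] closed[of z y] sym that by auto
  qed
qed

text \<open>Any bound \<open>w\<close> on clique sizes is allowed instead of the clique number, so
  that the same \<open>w\<close> serves all subsets in the induction. The cases are whether or not
  every vertex is the centre of a claw.\<close>

lemma colorable_if_no_diamond_no_odd_hole:
  assumes "X \<subseteq> V"
    and "\<And>x y s t. x \<in> X \<Longrightarrow> y \<in> X \<Longrightarrow> s \<in> X \<Longrightarrow> t \<in> X \<Longrightarrow> E x y \<Longrightarrow> E x s \<Longrightarrow> E x t \<Longrightarrow> E y s \<Longrightarrow> E y t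
      \<Longrightarrow> s \<noteq> t \<Longrightarrow> E s t"
    and "\<nexists>c n. odd_hole E c n \<and> range c \<subseteq> X"
    and "\<And>K. is_clique X E K \<Longrightarrow> card K \<le> w"
  shows "colorable X E w"
  using finite_subset[OF \<open>X \<subseteq> V\<close> finite_V] assms
proof (induction X rule: finite_psubset_induct)
  case (psubset X)
  note dia = psubset.prems(2)
  have IH: "colorable Y E w" if "Y \<subset> X" for Y
  proof (rule psubset.IH[OF that])
    show "\<nexists>c n. odd_hole E c n \<and> range c \<subseteq> Y"
      using psubset.prems(3) that by blast
    show "card K \<le> w" if "is_clique Y E K" for K
      using psubset.prems(4)[of K] that \<open>Y \<subset> X\<close> unfolding is_clique_def by blast
  qed (use that psubset.prems(1) dia in blast)+
  show ?case
  proof (cases "\<forall>x\<in>X. \<exists>p\<in>X. \<exists>q\<in>X. \<exists>r\<in>X. claw_at x p q r")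
    case True
    show ?thesis
    proof (cases "X = {}")
      case True
      then show ?thesis unfolding colorable_def by simp
    next
      case False
      then obtain x where "x \<in> X" by blast
      then obtain y where "y \<in> X" "E x y"
        using True unfolding claw_at_def by blast
      then have "is_clique X E {x, y}"
        using \<open>x \<in> X\<close> \<open>y \<in> X\<close> \<open>E x y\<close> sym unfolding is_clique_def by auto
      then have "card {x, y} \<le> w" by (rule psubset.prems(4))
      moreover have "x \<noteq> y" using \<open>E x y\<close> irrefl by blast
      ultimately have "2 \<le> w" by simp
      moreover have "\<not> E y z" if "x \<in> X" "y \<in> X" "z \<in> X" "E x y" "E x z" for x y z
      proof
        assume "E y z"
        show False
        proof (rule no_triangle_if_claws_everywhere[OF psubset.prems(1) _ _ that \<open>E y z\<close>])
          show "E s t" if "x \<in> X" "y \<in> X" "s \<in> X" "t \<in> X" "E x y" "E x s" "E x t" "E y s" "E y t"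
            "s \<noteq> t" for x y s t
            by (rule dia[OF that])
        qed (use True in blast)
      qed
      ultimately show ?thesis
        using colorable_if_claws_everywhere[of X w] psubset.prems(1) True False IH by blast
    qed
  next
    case False
    then obtain v where v: "v \<in> X" and nc: "\<And>p q r. {p, q, r} \<subseteq> X \<Longrightarrow> \<not> claw_at v p q r"
      by auto
    have "\<exists>K1 K2. {y \<in> X. E v y} = K1 \<union> K2
      \<and> (\<forall>y\<in>K1. \<forall>z\<in>K1. y \<noteq> z \<longrightarrow> E y z) \<and> (\<forall>y\<in>K2. \<forall>z\<in>K2. y \<noteq> z \<longrightarrow> E y z)
      \<and> (\<forall>y\<in>K1. \<forall>z\<in>K2. \<not> E y z) \<and> K1 \<inter> K2 = {}"
    proof (cases "\<exists>p\<in>X. E v p")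
      case True
      then obtain p where p: "p \<in> X" "E v p" by blast
      \<comment> \<open>Diamond-freeness makes \<open>K1\<close> a clique anticomplete to
        \<open>K2\<close>; two nonadjacent vertices of \<open>K2\<close> would form a claw at
        \<open>v\<close> with \<open>p\<close>.\<close>
      define K1 where "K1 = {y \<in> X. E v y \<and> (y = p \<or> E p y)}"
      define K2 where "K2 = {y \<in> X. E v y \<and> y \<noteq> p \<and> \<not> E p y}"
      have dia': "E s t" if "y \<in> X" "s \<in> X" "t \<in> X" "E v y" "E v s" "E v t" "E y s" "E y t" "s \<noteq> t" for y s t
        using dia[of v y s t] v that by simp
      have "E y z" if "y \<in> K1" "z \<in> K1" "y \<noteq> z" for y z
        using dia'[of p y z] that p sym unfolding K1_def by auto
      moreover have "E y z" if "y \<in> K2" "z \<in> K2" "y \<noteq> z" for y z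
        using nc[of p y z] that p unfolding K2_def claw_at_def by blast
      moreover have "\<not> E y z" if "y \<in> K1" "z \<in> K2" for y z
        using dia'[of y p z] that p sym unfolding K1_def K2_def by auto
      moreover have "{y \<in> X. E v y} = K1 \<union> K2" "K1 \<inter> K2 = {}"
        unfolding K1_def K2_def by blast+
      ultimately show ?thesis by (intro exI[of _ K1] exI[of _ K2] conjI ballI impI)
    qed blast
    then obtain K1 K2 where K: "{y \<in> X. E v y} = K1 \<union> K2"
      "\<forall>y\<in>K1. \<forall>z\<in>K1. y \<noteq> z \<longrightarrow> E y z" "\<forall>y\<in>K2. \<forall>z\<in>K2. y \<noteq> z \<longrightarrow> E y z"
      "\<forall>y\<in>K1. \<forall>z\<in>K2. \<not> E y z" "K1 \<inter> K2 = {}"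
      by (elim exE conjE)
    have "colorable (X - {v}) E w" using IH v by blast
    then show ?thesis
      using colorable_insert_two_cliques[OF psubset.prems(1) v _ psubset.prems(4) K(1)]
        K(2-5) psubset.prems(3) by simp
  qed
qed

lemma perfect_if_no_diamond_no_odd_hole:
  assumes U: "U \<subseteq> V"
    and dia: "\<And>x y s t. x \<in> U \<Longrightarrow> y \<in> U \<Longrightarrow> s \<in> U \<Longrightarrow> t \<in> U \<Longrightarrow> E x y \<Longrightarrow> E x s \<Longrightarrow> E x t \<Longrightarrow> E y s \<Longrightarrow> E y t
      \<Longrightarrow> s \<noteq> t \<Longrightarrow> E s t"
    and hole: "\<nexists>c n. odd_hole E c n \<and> range c \<subseteq> U"
  shows "perfect U (induced_rel E U)"
  unfolding perfect_def
proof (intro allI impI)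
  fix X assume X: "X \<subseteq> U"
  let ?E = "induced_rel (induced_rel E U) X"
  let ?w = "clique_number X ?E"
  \<comment> \<open>Restricting to \<open>U\<close> and then to \<open>X\<close> changes no
    adjacency inside \<open>X\<close>.\<close>
  have E: "?E x y \<longleftrightarrow> E x y" if "x \<in> X" "y \<in> X" for x y
    using that X unfolding induced_rel_def by blast
  have clique: "is_clique X ?E K \<longleftrightarrow> is_clique X E K" for K
    using E unfolding is_clique_def by blast
  have col: "colorable X ?E k \<longleftrightarrow> colorable X E k" for k
    using E unfolding colorable_def by (simp cong: ball_cong)
  have finX: "finite X"
    using X U finite_V by (meson finite_subset)
  have finC: "finite (card ` {K. is_clique X ?E K})"
    by (rule finite_imageI, rule finite_subset[of _ "Pow X"]) (use finX in \<open>auto simp: is_clique_def\<close>)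
  have w: "card K \<le> ?w" if "is_clique X E K" for K
    unfolding clique_number_def by (intro Max_ge finC) (use that clique in blast)
  have colw: "colorable X ?E ?w"
    unfolding col
  proof (intro colorable_if_no_diamond_no_odd_hole)
    show "E s t" if "x \<in> X" "y \<in> X" "s \<in> X" "t \<in> X" "E x y" "E x s" "E x t" "E y s" "E y t"
      "s \<noteq> t" for x y s t
      using dia[of x y s t] that X by blast
    show "X \<subseteq> V" using X U by blast
    show "\<nexists>c n. odd_hole E c n \<and> range c \<subseteq> X" using hole X by blast
  qed (rule w)
  have "?w \<in> card ` {K. is_clique X ?E K}"
    unfolding clique_number_def by (intro Max_in finC) (auto simp: is_clique_def)
  then obtain K where K: "is_clique X ?E K" "card K = ?w" by force
  show "chromatic_number X ?E = ?w"
    unfolding chromatic_number_def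
  proof (rule Least_equality, rule colw)
    fix k assume "colorable X ?E k"
    then obtain \<kappa> :: "'a \<Rightarrow> nat" where \<kappa>: "\<And>x. x \<in> X \<Longrightarrow> \<kappa> x < k"
      "\<And>x y. x \<in> X \<Longrightarrow> y \<in> X \<Longrightarrow> ?E x y \<Longrightarrow> \<kappa> x \<noteq> \<kappa> y"
      unfolding colorable_def by blast
    have "inj_on \<kappa> K" "\<kappa> ` K \<subseteq> {..<k}"
      using \<kappa> K unfolding is_clique_def inj_on_def by blast+
    then show "?w \<le> k"
      using card_inj_on_le[of \<kappa> K "{..<k}"] K by simp
  qed
qed

end

locale fork_cocricket_free_graph = fork_free_graph +
  assumes cocricket_free: "H_free cocricket_V cocricket_E V E"
begin

text \<open>The diamond has the middle edge \<open>x y\<close> and the nonadjacent tips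
  \<open>s\<close>, \<open>t\<close>; the isolated vertex is \<open>z\<close>.\<close>

lemma no_cocricket:
  assumes "E x y" "E x s" "E x t" "E y s" "E y t" "s \<noteq> t" "\<not> E s t"
    and "z \<in> V" "\<not> E z x" "\<not> E z y" "\<not> E z s" "\<not> E z t"
  shows False
proof -
  define f :: "nat \<Rightarrow> 'a" where
    "f k = (if k = 0 then x else if k = 1 then y else if k = 2 then s else if k = 3 then t else z)" for k
  have "x \<noteq> y" "x \<noteq> s" "x \<noteq> t" "x \<noteq> z" "y \<noteq> s" "y \<noteq> t" "y \<noteq> z" "s \<noteq> z" "t \<noteq> z"
    using assms irrefl sym by metis+
  moreover have "E y x" "E s x" "E t x" "E s y" "E t y" "\<not> E t s"
    "\<not> E x z" "\<not> E y z" "\<not> E s z" "\<not> E t z"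
    using assms sym by metis+
  moreover have "x \<in> V" "y \<in> V" "s \<in> V" "t \<in> V"
    using assms in_V by metis+
  ultimately have "inj_on f cocricket_V \<and> f ` cocricket_V \<subseteq> V
    \<and> (\<forall>y\<in>cocricket_V. \<forall>z\<in>cocricket_V. E (f y) (f z) \<longleftrightarrow> cocricket_E y z)"
    using assms irrefl
    unfolding f_def cocricket_V_def cocricket_E_def edges_rel_def inj_on_def
    by (simp add: doubleton_eq_iff)
  then show False
    using cocricket_free unfolding H_free_def contains_induced_def by blast
qed

end

section \<open>Odd holes with a vertex anticomplete to them\<close>

text \<open>The hole is indexed by the integers modulo \<open>n\<close>, so that shifting indices needs no case
  distinctions at the ends; \<open>a0\<close> witnesses that the hole lies inside some \<open>M(u)\<close>.\<close>

locale far_odd_hole = fork_cocricket_free_graph +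
  fixes c :: "int \<Rightarrow> 'a" and n :: int and a0 :: 'a
  assumes prime: "\<not> homogeneous_set V E S"
    and hole: "odd_hole E c n"
    and a0: "a0 \<in> V" "\<not> E a0 (c i)"
begin

lemma n5: "5 \<le> n" and odd_n: "odd n"
  and hole_eq: "c i = c j \<longleftrightarrow> n dvd i - j"
  and hole_adj: "E (c i) (c j) \<longleftrightarrow> n dvd i - j - 1 \<or> n dvd i - j + 1"
  using hole unfolding odd_hole_def by auto

lemma not_dvd: "k \<noteq> 0 \<Longrightarrow> \<bar>k\<bar> < n \<Longrightarrow> \<not> n dvd k"
  using zdvd_imp_le[of n "\<bar>k\<bar>"] by auto

text \<open>The first fact stands for \<open>\<not> n dvd 1\<close>.\<close>

lemma not_dvd_small: "\<bar>n\<bar> \<noteq> 1" "\<not> n dvd 2" "\<not> n dvd 3" "\<not> n dvd 4"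
  using n5 not_dvd[of 2] not_dvd[of 3] not_dvd[of 4] by auto

lemma not_dvd_5_6:
  assumes "n \<noteq> 5"
  shows "\<not> n dvd 5" "\<not> n dvd 6"
proof -
  have "7 \<le> n" using n5 odd_n assms by presburger
  then show "\<not> n dvd 5" "\<not> n dvd 6" using not_dvd[of 5] not_dvd[of 6] by auto
qed

lemma not_dvd_8: "\<not> n dvd 8"
proof
  assume "n dvd 8"
  then have "n \<le> 8" by (simp add: zdvd_imp_le)
  then have "n = 5 \<or> n = 7" using n5 odd_n by presburger
  then show False using \<open>n dvd 8\<close> by auto
qed

section \<open>How outside vertices attach to the hole\<close>

definition off :: "'a \<Rightarrow> bool" where
  "off y \<longleftrightarrow> (\<forall>i. y \<noteq> c i)"

definition far :: "'a \<Rightarrow> bool" where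
  "far a \<longleftrightarrow> a \<in> V \<and> (\<forall>i. \<not> E a (c i))"

definition edge :: "'a \<Rightarrow> int \<Rightarrow> bool" where
  "edge z i \<longleftrightarrow> (\<forall>j. E z (c j) \<longleftrightarrow> n dvd j - i \<or> n dvd j - i - 1)"

lemma off_neq: "off y \<Longrightarrow> y \<noteq> c i" "off y \<Longrightarrow> c i \<noteq> y"
  unfolding off_def by metis+

lemma off_flip: "off y \<Longrightarrow> E (c i) y \<longleftrightarrow> E y (c i)"
  using sym by blast

lemmas hole_simps = hole_adj hole_eq not_dvd_small off_neq off_flip algebra_simps

lemma hole_next: "E (c i) (c (i + 1))"
  by (simp add: hole_simps)

lemma far_a0: "far a0"
  using a0 unfolding far_def by blast

lemma far_not_adj: "far a \<Longrightarrow> \<not> E a (c i)"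
  unfolding far_def by blast

lemma far_off: "far a \<Longrightarrow> off a"
  using hole_next unfolding far_def off_def by blast

lemma adj_far_off: "far a \<Longrightarrow> E y a \<Longrightarrow> off y"
  using sym unfolding far_def off_def by blast

lemma edgeD: "edge z i \<Longrightarrow> E z (c j) \<longleftrightarrow> n dvd j - i \<or> n dvd j - i - 1"
  unfolding edge_def by blast

lemma edge_dvd:
  assumes "edge z m" "n dvd i - m"
  shows "edge z i"
proof -
  have "n dvd k - m \<longleftrightarrow> n dvd k - i" for k
    using assms(2) dvd_add[of n "k - i" "i - m"] dvd_diff[of n "k - m" "i - m"] by auto
  from this this[of "k - 1" for k] show ?thesis
    using assms(1) unfolding edge_def by (simp add: algebra_simps)
qed

lemma edge_at: "edge z m \<Longrightarrow> E z (c i) \<Longrightarrow> edge z i \<or> edge z (i - 1)"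
  using edge_dvd[of z m i] edge_dvd[of z m "i - 1"] edgeD[of z m i] by (auto simp: algebra_simps)

lemma edge_at_pair: "edge z m \<Longrightarrow> E z (c i) \<Longrightarrow> E z (c (i + 1)) \<Longrightarrow> edge z i"
  using edge_at[of z m i] edgeD[of z "i - 1" "i + 1"] by (auto simp: hole_simps)

text \<open>Forward steps alone reach every vertex of a cycle: \<open>(j - k) mod n\<close> of them
  lead from \<open>c k\<close> to \<open>c j\<close>.\<close>

lemma hole_induct:
  assumes "P (c k)" and "\<And>i. P (c i) \<Longrightarrow> P (c (i + 1))"
  shows "P (c j)"
proof -
  have "P (c (k + int m))" for m
  proof (induction m)
    case (Suc m)
    then show ?case using assms(2)[of "k + int m"] by (simp add: algebra_simps)
  qed (use assms in simp)
  from this[of "nat ((j - k) mod n)"] have "P (c (k + (j - k) mod n))"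
    using n5 by simp
  moreover have "n dvd k + (j - k) mod n - j"
    using mod_eq_dvd_iff[of "k + (j - k) mod n" n j] by (simp add: mod_add_right_eq)
  ultimately show ?thesis using hole_eq by metis
qed

text \<open>The far neighbour \<open>a\<close> is a spare leaf: forks at \<open>y\<close> force each
  neighbour of \<open>y\<close> on the hole to be adjacent to an end of every hole edge of which
  \<open>y\<close> sees one end only.\<close>

lemma adj_far_cases:
  assumes a: "far a" and y: "E y a" "E y (c k)"
  shows "(\<forall>i. E y (c i)) \<or> (\<exists>i. edge y i)"
proof (rule ccontr)
  assume neg: "\<not> ?thesis"
  have off: "off y" "off a" using adj_far_off far_off a y by blast+
  note aux = off far_not_adj[OF a] y(1) hole_simps
  obtain i where i: "E y (c i)" "\<not> E y (c (i + 1))"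
    using hole_induct[of "E y" k] y neg by blast
  have gen: "E (c j) (c s) \<or> E (c j) (c t)"
    if "E (c s) (c t)" "E y (c s)" "\<not> E y (c t)" "E y (c j)" for s t j
  proof (rule ccontr)
    assume "\<not> ?thesis"
    then show False
      by (intro no_fork[of y a "c j" "c s" "c t"]) (use that aux far_not_adj[OF a] in auto)
  qed
  have i2: "\<not> E y (c (i + 2))"
  proof
    assume i2: "E y (c (i + 2))"
    have "\<not> E y (c (i - 1))"
      using gen[of "i + 2" "i + 1" "i - 1"] i i2 by (auto simp: hole_simps)
    then show False
      using gen[of i "i - 1" "i + 2"] i i2 by (auto simp: hole_simps)
  qed
  have i1: "E y (c (i - 1))"
    by (rule ccontr, rule no_fork[of "c i" y "c (i - 1)" "c (i + 1)" "c (i + 2)"])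
      (use i i2 off in \<open>simp_all add: hole_simps\<close>)
  have "edge y (i - 1)"
    unfolding edge_def
  proof (intro allI iffI)
    fix j assume j: "E y (c j)"
    then have "E (c j) (c i) \<or> E (c j) (c (i + 1))"
      using gen[of i "i + 1" j] i hole_next by blast
    moreover have "\<not> n dvd j - (i + 1)" "\<not> n dvd j - (i + 2)"
      using j i i2 hole_eq by metis+
    ultimately show "n dvd j - (i - 1) \<or> n dvd j - (i - 1) - 1"
      by (auto simp: hole_adj algebra_simps)
  next
    fix j assume "n dvd j - (i - 1) \<or> n dvd j - (i - 1) - 1"
    then have "c j = c (i - 1) \<or> c j = c i"
      by (simp add: hole_eq algebra_simps)
    then show "E y (c j)" using i i1 by auto
  qed
  then show False using neg by blast
qed

text \<open>The complete vertices would be joined to everything else, so that the rest is homogeneous.\<close>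

lemma no_complete: "\<not> (\<forall>i. E y (c i))"
proof
  assume y: "\<forall>i. E y (c i)"
  define K where "K = {y. \<forall>i. E y (c i)}"
  have offK: "off z" if "z \<in> K" for z
    using that irrefl unfolding K_def off_def by blast
  \<comment> \<open>Otherwise \<open>z\<close>, three consecutive hole vertices and \<open>a\<close>
    would form a co-cricket.\<close>
  have far_K: "E z a" if "z \<in> K" "far a" for z a
    by (rule ccontr, rule no_cocricket[of z "c 1" "c 0" "c 2" a])
      (use that offK far_off[OF that(2)] in \<open>auto simp: far_def K_def hole_adj hole_eq not_dvd_small commute[of a z] off_flip\<close>)
  have join: "E z v" if z: "z \<in> K" and v: "v \<in> V" "v \<notin> K" for z v
  proof (rule ccontr)
    assume zv: "\<not> E z v"
    have zc: "E z (c i)" for i using z unfolding K_def by blast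
    have za: "E z a0" using far_K far_a0 z by blast
    have "\<not> far v" using far_K z zv by blast
    then obtain k where k: "E v (c k)" using v unfolding far_def by blast
    have "off v" using zc zv unfolding off_def by blast
    note offs = \<open>off v\<close> offK[OF z] far_off[OF far_a0]
    show False
    proof (cases "E v a0")
      case True
      then obtain i where "edge v i"
        using adj_far_cases[OF far_a0 _ k] v unfolding K_def by blast
      \<comment> \<open>On the hole \<open>v\<close> sees just \<open>c i\<close> and
        \<open>c (i + 1)\<close>, so it misses the diamond formed by \<open>z\<close> and the three
        vertices after them.\<close>
      then show False
        by (intro no_cocricket[of z "c (i + 3)" "c (i + 2)" "c (i + 4)" v])
          (use offs zc zv v sym[of v z] in \<open>auto simp: hole_simps edgeD[of v i]\<close>)
    next
      case False
      \<comment> \<open>A fork at \<open>z\<close> passes adjacency to \<open>v\<close> from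
        \<open>c i\<close> to every hole vertex nonadjacent to it; going to \<open>i + 3\<close> and
        back to \<open>i + 1\<close> then covers the hole.\<close>
      have step: "E v (c j)" if "E v (c i)" "\<not> E (c i) (c j)" "c i \<noteq> c j" for i j
        by (rule ccontr, rule no_fork[of z a0 "c j" "c i" v])
          (use that offs za zc zv False a0 sym[of a0 v] in \<open>auto simp: off_neq off_flip commute[of "c j" "c i"]\<close>)
      have "E v (c (i + 1))" if "E v (c i)" for i
        using step[of i "i + 3"] step[of "i + 3" "i + 1"] that by (simp add: hole_simps)
      then have "E v (c j)" for j
        using hole_induct[of "E v"] k by blast
      then show False using v unfolding K_def by blast
    qed
  qed
  have "K \<subseteq> V" using in_V unfolding K_def by blast
  moreover have "y \<in> K" using y unfolding K_def by blast
  ultimately have "card (V - K) < card V"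
    using finite_V by (intro psubset_card_mono) auto
  moreover have "{c 0, c 1} \<subseteq> V - K"
    using irrefl hole_next in_V unfolding K_def by blast
  then have "card {c 0, c 1} \<le> card (V - K)"
    using finite_V by (intro card_mono) auto
  then have "1 < card (V - K)"
    by (simp add: hole_eq not_dvd_small)
  ultimately have "homogeneous_set V E (V - K)"
    using join unfolding homogeneous_set_def by blast
  then show False using prime by blast
qed

lemma adj_far_edge: "far a \<Longrightarrow> E y a \<Longrightarrow> E y (c k) \<Longrightarrow> \<exists>i. edge y i"
  using adj_far_cases no_complete by blast

text \<open>Otherwise no edge joins a far vertex to one that is not far, and the vertices that are
  not far form a homogeneous set.\<close>

lemma ex_edge_adj_far: "\<exists>y a i. far a \<and> E y a \<and> edge y i"
proof (rule ccontr)
  assume neg: "\<not> ?thesis"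
  define S where "S = {v \<in> V. \<not> far v}"
  have "\<not> E v s" if "far v" "s \<in> S" for v s
    using adj_far_edge[of v s] that neg sym unfolding S_def far_def by blast
  moreover have "card S < card V"
    using finite_V a0 far_a0 by (intro psubset_card_mono) (auto simp: S_def)
  moreover have "{c 0, c 1} \<subseteq> S"
    using hole_next[of 0] hole_next[of 1] hole_next[of "-1"] in_V sym unfolding S_def far_def by auto
  then have "card {c 0, c 1} \<le> card S"
    using finite_V by (intro card_mono) (auto simp: S_def)
  then have "1 < card S"
    by (simp add: hole_eq not_dvd_small)
  ultimately have "homogeneous_set V E S"
    unfolding homogeneous_set_def S_def by blast
  then show False using prime by blast
qed

text \<open>If \<open>a0\<close> sees \<open>z\<close>, the trace of \<open>z\<close> on the hole is
  one edge; if not, \<open>z\<close> and the three hole vertices form a diamond that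
  \<open>a0\<close> misses.\<close>

lemma no_three_consecutive:
  assumes z: "off z" "E z (c i)" "E z (c (i + 1))"
  shows "\<not> E z (c (i + 2))"
proof
  assume i2: "E z (c (i + 2))"
  show False
  proof (cases "E z a0")
    case True
    then obtain m where "edge z m" using adj_far_edge far_a0 z by blast
    then have "edge z i" using edge_at_pair z by blast
    then show False using i2 edgeD[of z i "i + 2"] by (simp add: hole_simps)
  next
    case False
    then show False
      by (intro no_cocricket[of "c (i + 1)" z "c i" "c (i + 2)" a0])
        (use z i2 a0 sym[of a0 z] in \<open>auto simp: hole_simps\<close>)
  qed
qed

text \<open>Forks at \<open>c i\<close> force \<open>z\<close> onto \<open>c (i + 2)\<close> and
  \<open>c (i - 2)\<close>. In longer holes forks at \<open>z\<close> continue to distance three,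
  and the missing \<open>c (i + 4)\<close> gives the contradiction. For \<open>n = 5\<close>, where
  \<open>i + 3\<close> and \<open>i - 2\<close> coincide, a second vertex \<open>y\<close> with a
  far neighbour is brought in.\<close>

lemma no_isolated:
  assumes z: "off z" "E z (c i)" "\<not> E z (c (i - 1))" "\<not> E z (c (i + 1))"
  shows False
proof -
  \<comment> \<open>An isolated neighbour rules out the trace \<open>edge\<close>, so by
    \<open>adj_far_edge\<close> the vertex \<open>z\<close> has no far neighbour.\<close>
  have nedge: "\<not> edge z m" for m
    using edge_at[of z m i] edgeD[of z i "i + 1"] edgeD[of z "i - 1" "i - 1"] z by auto
  then have nfar: "\<not> E z a" if "far a" for a
    using adj_far_edge that z by blast
  have p2: "E z (c (i + 2))"
    by (rule ccontr, rule no_fork[of "c i" "c (i - 1)" z "c (i + 1)" "c (i + 2)"])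
      (use z in \<open>simp_all add: hole_simps\<close>)
  have m2: "E z (c (i - 2))"
    by (rule ccontr, rule no_fork[of "c i" "c (i + 1)" z "c (i - 1)" "c (i - 2)"])
      (use z in \<open>simp_all add: hole_simps\<close>)
  show False
  proof (cases "n = 5")
    case False
    note big = not_dvd_5_6[OF False]
    have p3: "E z (c (i + 3))"
      by (rule ccontr, rule no_fork[of z "c i" "c (i - 2)" "c (i + 2)" "c (i + 3)"])
        (use z p2 m2 big in \<open>simp_all add: hole_simps\<close>)
    have m3: "E z (c (i - 3))"
      by (rule ccontr, rule no_fork[of z "c i" "c (i + 2)" "c (i - 2)" "c (i - 3)"])
        (use z p2 m2 big in \<open>simp_all add: hole_simps\<close>)
    have p4: "\<not> E z (c (i + 4))"
      using no_three_consecutive[of z "i + 2"] z p2 p3 by (simp add: algebra_simps)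
    show False
    proof (cases "n = 7")
      case True
      then have "c (i - 3) = c (i + 4)" by (simp add: hole_eq)
      then show False using m3 p4 by simp
    next
      case n7: False
      have "9 \<le> n" using n5 odd_n False n7 by presburger
      then have "\<not> n dvd 7" using not_dvd[of 7] by simp
      then show False
        by (intro no_fork[of z "c i" "c (i - 2)" "c (i + 3)" "c (i + 4)"])
          (use z p2 m2 p3 p4 big in \<open>simp_all add: hole_simps\<close>)
    qed
  next
    case n: True
    obtain y a j where y: "far a" "E y a" "edge y j" using ex_edge_adj_far by blast
    have offs: "off y" "off a" "E a y" using adj_far_off far_off sym y by blast+
    have za: "\<not> E z a" "\<not> E a z" using nfar y sym by blast+
    \<comment> \<open>The position of the edge of \<open>y\<close> relative to \<open>i\<close>,
      reduced to the range from -2 to 2.\<close>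
    define t where "t = (j - i + 2) mod 5 - 2"
    have "5 dvd i + t - j"
      unfolding t_def by presburger
    then have et: "edge y (i + t)" using edge_dvd[OF y(3)] n by simp
    have "t = -2 \<or> t = -1 \<or> t = 0 \<or> t = 1 \<or> t = 2"
      unfolding t_def by presburger
    then have cases: "edge y (i - 2) \<or> edge y (i - 1) \<or> edge y i \<or> edge y (i + 1) \<or> edge y (i + 2)"
      using et by auto
    note facts = z p2 m2 offs y(1,2) za far_not_adj[OF y(1)] n
    show False
    proof (cases "E z y")
      case zy: True
      note zy' = zy sym[OF zy]
      from cases show False
      proof (elim disjE)
        assume e: "edge y (i - 2)"
        show False
          by (rule no_fork[of z "c i" "c (i + 2)" y a])
            (use facts zy' in \<open>simp_all add: hole_simps edgeD[OF e]\<close>)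
      next
        assume e: "edge y (i - 1)"
        show False
          by (rule no_fork[of y a "c (i - 1)" z "c (i + 2)"])
            (use facts zy' in \<open>simp_all add: hole_simps edgeD[OF e]\<close>)
      next
        assume e: "edge y i"
        show False
          by (rule no_fork[of y a "c (i + 1)" z "c (i - 2)"])
            (use facts zy' in \<open>simp_all add: hole_simps edgeD[OF e]\<close>)
      next
        assume e: "edge y (i + 1)"
        show False
          by (rule no_fork[of z "c i" "c (i - 2)" y a])
            (use facts zy' in \<open>simp_all add: hole_simps edgeD[OF e]\<close>)
      next
        assume e: "edge y (i + 2)"
        show False
          by (rule no_fork[of "c i" "c (i - 1)" "c (i + 1)" z y])
            (use facts zy' in \<open>simp_all add: hole_simps edgeD[OF e]\<close>)
      qed
    next
      case zy: False
      then have zy': "\<not> E z y" "\<not> E y z" "y \<noteq> z" using sym y za by blast+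
      from cases show False
      proof (elim disjE)
        assume e: "edge y (i - 2)"
        show False
          by (rule no_fork[of "c i" "c (i + 1)" z "c (i - 1)" y])
            (use facts zy' in \<open>simp_all add: hole_simps edgeD[OF e]\<close>)
      next
        assume e: "edge y (i - 1)"
        show False
          by (rule no_fork[of "c i" "c (i + 1)" z y a])
            (use facts zy' in \<open>simp_all add: hole_simps edgeD[OF e]\<close>)
      next
        assume e: "edge y i"
        show False
          by (rule no_fork[of "c i" "c (i - 1)" z y a])
            (use facts zy' in \<open>simp_all add: hole_simps edgeD[OF e]\<close>)
      next
        assume e: "edge y (i + 1)"
        show False
          by (rule no_fork[of "c i" "c (i - 1)" z "c (i + 1)" y])
            (use facts zy' in \<open>simp_all add: hole_simps edgeD[OF e]\<close>)
      next
        assume e: "edge y (i + 2)"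
        show False
          by (rule no_fork[of "c (i + 2)" "c (i + 1)" z y a])
            (use facts zy' in \<open>simp_all add: hole_simps edgeD[OF e]\<close>)
      qed
    qed
  qed
qed

text \<open>Hence the neighbours of \<open>z\<close> on the hole come in runs of exactly
  two.\<close>

lemma exactly_one_side:
  assumes "off z" "E z (c i)"
  shows "E z (c (i - 1)) \<longleftrightarrow> \<not> E z (c (i + 1))"
  using no_isolated[of z i] no_three_consecutive[of z "i - 1"] assms by (auto simp: algebra_simps)

text \<open>In contrast to \<open>edge\<close>, further neighbours on the hole are permitted:
  \<open>z\<close> may lie on a second edge as well.\<close>

definition on_edge :: "'a \<Rightarrow> int \<Rightarrow> bool" where
  "on_edge z i \<longleftrightarrow> off z \<and> E z (c i) \<and> E z (c (i + 1))"

lemma on_edgeD: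
  assumes "on_edge z i"
  shows "off z" "E z (c i)" "E z (c (i + 1))" "\<not> E z (c (i + 2))" "\<not> E z (c (i - 1))"
  using assms no_three_consecutive[of z i] exactly_one_side[of z i] unfolding on_edge_def by auto

lemma on_edge_edge: "on_edge z i \<Longrightarrow> far a \<Longrightarrow> E z a \<Longrightarrow> edge z i"
  using adj_far_edge edge_at_pair on_edgeD by blast

lemma ex_on_edge: "off z \<Longrightarrow> E z (c i) \<Longrightarrow> on_edge z i \<or> on_edge z (i - 1)"
  using exactly_one_side[of z i] unfolding on_edge_def by auto

text \<open>Two nonadjacent vertices on one edge form a diamond with it, so \<open>a0\<close> sees
  one of them, say \<open>z\<close>, whose trace is then just this edge. Forks at its ends force
  \<open>z'\<close> onto \<open>c (i + 3)\<close> and \<open>c (i - 2)\<close>; for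
  \<open>n = 5\<close> this is an isolated neighbour, otherwise it yields another fork.\<close>

lemma on_edge_clique:
  assumes "on_edge z i" "on_edge z' i" "z \<noteq> z'"
  shows "E z z'"
proof (rule ccontr)
  assume "\<not> E z z'"
  have main: False
    if zi: "on_edge z i" and zi': "on_edge z' i" and zz: "z \<noteq> z'" "\<not> E z z'" and za: "E z a0" for z z'
  proof -
    note e = edgeD[OF on_edge_edge[OF zi far_a0 za]]
    note facts = on_edgeD[OF zi] on_edgeD[OF zi'] zz sym[of z' z]
    have p3: "E z' (c (i + 3))"
      by (rule ccontr, rule no_fork[of "c (i + 1)" z z' "c (i + 2)" "c (i + 3)"])
        (use facts in \<open>auto simp: hole_simps e\<close>)
    have m2: "E z' (c (i - 2))"
      by (rule ccontr, rule no_fork[of "c i" z z' "c (i - 1)" "c (i - 2)"])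
        (use facts in \<open>auto simp: hole_simps e\<close>)
    show False
    proof (cases "n = 5")
      case True
      then have "c (i + 4) = c (i - 1)" by (simp add: hole_eq)
      then show False
        using no_isolated[of z' "i + 3"] p3 facts by (simp add: algebra_simps)
    next
      case False
      show False
        by (rule no_fork[of "c (i + 1)" z "c (i + 2)" z' "c (i - 2)"])
          (use facts m2 not_dvd_5_6[OF False] in \<open>auto simp: hole_simps e\<close>)
    qed
  qed
  have "E z a0 \<or> E z' a0"
    by (rule ccontr, rule no_cocricket[of "c i" "c (i + 1)" z z' a0])
      (use on_edgeD[OF assms(1)] on_edgeD[OF assms(2)] assms(3) \<open>\<not> E z z'\<close> a0 sym[of a0 z] sym[of a0 z']
        in \<open>auto simp: hole_simps\<close>)
  then show False
    using main[of z z'] main[of z' z] assms \<open>\<not> E z z'\<close> sym by metis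
qed

text \<open>If \<open>z\<close> and \<open>p\<close> were adjacent, they would form a diamond with
  \<open>c i\<close> and \<open>c (i + 1)\<close>, so \<open>a0\<close> sees one of them. Seeing
  only one gives a fork; seeing both gives a diamond \<open>z\<close>, \<open>p\<close>,
  \<open>a0\<close>, \<open>c i\<close> missed by \<open>c (i + 3)\<close>.\<close>

lemma consecutive_edges_anticomplete:
  assumes z: "on_edge z i" and p: "on_edge p (i - 1)"
  shows "\<not> E z p"
proof
  assume zp: "E z p"
  have p': "off p" "E p (c (i - 1))" "E p (c i)" "\<not> E p (c (i + 1))" "\<not> E p (c (i - 2))"
    using on_edgeD[OF p] by (simp_all add: algebra_simps)
  note facts = on_edgeD[OF z] p' zp sym[OF zp] far_off[OF far_a0] a0
  have "E z a0 \<or> E p a0"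
    by (rule ccontr, rule no_cocricket[of "c i" z p "c (i + 1)" a0])
      (use facts sym[of a0 z] sym[of a0 p] in \<open>auto simp: hole_simps\<close>)
  then consider "E z a0" "\<not> E p a0" | "E z a0" "E p a0" | "\<not> E z a0" "E p a0" by blast
  then show False
  proof cases
    case 1
    show False
      by (rule no_fork[of z a0 "c (i + 1)" p "c (i - 1)"])
        (use facts 1 sym[of a0 p] in \<open>auto simp: hole_simps\<close>)
  next
    case 2
    note ez = edgeD[OF on_edge_edge[OF z far_a0 2(1)]] and ep = edgeD[OF on_edge_edge[OF p far_a0 2(2)]]
    show False
      by (rule no_cocricket[of z p a0 "c i" "c (i + 3)"])
        (use facts 2 in_V(1)[OF hole_next] in \<open>simp_all add: hole_simps ez ep\<close>)
  next
    case 3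
    show False
      by (rule no_fork[of p a0 "c (i - 1)" z "c (i + 1)"])
        (use facts 3 sym[of a0 z] in \<open>auto simp: hole_simps\<close>)
  qed
qed

text \<open>A neighbour of \<open>z\<close> seeing one end only would lie on a consecutive
  edge.\<close>

lemma neighbour_on_edge_iff:
  assumes z: "on_edge z i" and p: "off p" "E z p"
  shows "E p (c i) \<longleftrightarrow> E p (c (i + 1))"
proof
  assume "E p (c i)"
  then have "on_edge p i \<or> on_edge p (i - 1)" using ex_on_edge p by blast
  then show "E p (c (i + 1))"
    using consecutive_edges_anticomplete[OF z] p on_edgeD by blast
next
  assume "E p (c (i + 1))"
  then have "on_edge p (i + 1) \<or> on_edge p i" using ex_on_edge[of p "i + 1"] p by simp
  then show "E p (c i)"
    using consecutive_edges_anticomplete[of p "i + 1" z] z p on_edgeD sym by auto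
qed

section \<open>No claw is centred on the hole or at a vertex touching it\<close>

definition edge_clique :: "int \<Rightarrow> 'a set" where
  "edge_clique i = {c i, c (i + 1)} \<union> {z. on_edge z i}"

lemma edge_clique:
  assumes "y \<in> edge_clique i" "z \<in> edge_clique i" "y \<noteq> z"
  shows "E y z"
proof -
  have "E (c i) (c (i + 1))" "E (c (i + 1)) (c i)"
    using hole_next sym by blast+
  moreover have "E w (c i)" "E w (c (i + 1))" "E (c i) w" "E (c (i + 1)) w" if "on_edge w i" for w
    using on_edgeD(2,3)[OF that] sym by blast+
  ultimately show ?thesis
    using assms on_edge_clique[of y i z]
    unfolding edge_clique_def Un_iff insert_iff empty_iff mem_Collect_eq by metis
qed

lemma no_claw_at_hole: "\<not> claw_at (c i) p q r"
proof (rule not_claw_at_if_two_cliques)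
  show "y \<in> edge_clique i \<or> y \<in> edge_clique (i - 1)" if "E (c i) y" for y
  proof (cases "off y")
    case True
    then show ?thesis using ex_on_edge[of y i] that sym unfolding edge_clique_def by blast
  next
    case False
    then obtain j where "y = c j" unfolding off_def by blast
    then have "n dvd j - (i - 1) \<or> n dvd j - (i + 1)"
      using that sym[of "c i" y] by (auto simp: hole_adj algebra_simps)
    then have "y = c (i - 1) \<or> y = c (i + 1)" using \<open>y = c j\<close> hole_eq by blast
    then show ?thesis unfolding edge_clique_def by auto
  qed
qed (fact edge_clique)+

text \<open>The second clique consists of the outside neighbours that miss both ends of the edge:
  forks at \<open>z\<close> push two nonadjacent ones onto \<open>c (i + 2)\<close>, thus onto a
  common edge, against \<open>on_edge_clique\<close>.\<close>

lemma no_claw_at_edge: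
  assumes z: "off z" and e: "edge z i"
  shows "\<not> claw_at z p q r"
proof (rule not_claw_at_if_two_cliques)
  have zi: "on_edge z i" using z edgeD[OF e] unfolding on_edge_def by simp
  note facts = on_edgeD[OF zi]
  let ?B = "{y. off y \<and> E z y \<and> \<not> E y (c i) \<and> \<not> E y (c (i + 1))}"
  show "y \<in> edge_clique i \<or> y \<in> ?B" if "E z y" for y
  proof (cases "off y")
    case True
    then show ?thesis
      using neighbour_on_edge_iff[OF zi True that] that unfolding edge_clique_def on_edge_def by blast
  next
    case False
    then obtain j where j: "y = c j" unfolding off_def by blast
    then have "n dvd j - i \<or> n dvd j - (i + 1)"
      using that edgeD[OF e] by (simp add: algebra_simps)
    then have "y = c i \<or> y = c (i + 1)" using j hole_eq by blast
    then show ?thesis unfolding edge_clique_def by auto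
  qed
  show "E p q" if "p \<in> ?B" "q \<in> ?B" "p \<noteq> q" for p q
  proof (rule ccontr)
    assume pq: "\<not> E p q"
    have both: "E q (c (i + 2))"
      if "off p" "E z p" "\<not> E p (c i)" "\<not> E p (c (i + 1))" "off q" "E z q" "\<not> E q (c i)"
        "\<not> E q (c (i + 1))" "p \<noteq> q" "\<not> E p q" "E p (c (i + 2))" for p q
      by (rule ccontr, rule no_fork[of z q "c i" p "c (i + 2)"])
        (use that facts sym[of q p] in \<open>auto simp: hole_simps\<close>)
    have "E p (c (i + 2)) \<or> E q (c (i + 2))"
      by (rule ccontr, rule no_fork[of z p q "c (i + 1)" "c (i + 2)"])
        (use that facts pq in \<open>auto simp: hole_simps\<close>)
    then have "E p (c (i + 2))" "E q (c (i + 2))"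
      using both[of p q] both[of q p] that pq sym[of q p] unfolding mem_Collect_eq by metis+
    then have "on_edge p (i + 2)" "on_edge q (i + 2)"
      using that ex_on_edge[of p "i + 2"] ex_on_edge[of q "i + 2"] on_edgeD(2)[of p "i + 1"]
        on_edgeD(2)[of q "i + 1"] by (auto simp: algebra_simps)
    then show False using on_edge_clique[of p "i + 2" q] that(3) pq by blast
  qed
qed (fact edge_clique)

text \<open>Otherwise the edges would overlap or abut, giving \<open>z\<close> three consecutive
  neighbours.\<close>

lemma two_edges_apart:
  assumes "on_edge z i" "on_edge z j" "\<not> n dvd j - i"
  shows "\<not> n dvd j - i - 1" "\<not> n dvd j - i + 1" "\<not> n dvd j - i - 2" "\<not> n dvd j - i + 2"
proof -
  have *: "\<not> n dvd j - (i + 1)" "\<not> n dvd j - (i + 2)" if "on_edge z i" "on_edge z j" for i j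
  proof -
    show "\<not> n dvd j - (i + 2)"
      using on_edgeD[OF that(1)] on_edgeD[OF that(2)] hole_eq by metis
    show "\<not> n dvd j - (i + 1)"
    proof
      assume "n dvd j - (i + 1)"
      then have "c (j + 1) = c (i + 2)" by (simp add: hole_eq algebra_simps)
      then show False using on_edgeD[OF that(1)] on_edgeD[OF that(2)] by simp
    qed
  qed
  have "n dvd i - (j + k) \<longleftrightarrow> n dvd j - i + k" for k
    using dvd_minus_iff[of n "j - i + k"] by (simp add: algebra_simps)
  from this[of 1] this[of 2]
  show "\<not> n dvd j - i - 1" "\<not> n dvd j - i + 1" "\<not> n dvd j - i - 2" "\<not> n dvd j - i + 2"
    using *[OF assms(1,2)] *[OF assms(2,1)] by (simp_all add: algebra_simps)
qed

text \<open>One end of each edge gives three pairwise nonadjacent neighbours, and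
  \<open>c (i + 2)\<close> lengthens the branch through \<open>c (i + 1)\<close> to a fork.\<close>

lemma at_most_two_edges:
  assumes "on_edge z i" "on_edge z j" "on_edge z k"
    and "\<not> n dvd j - i" "\<not> n dvd k - i" "\<not> n dvd k - j"
  shows False
proof -
  note d = two_edges_apart[OF assms(1,2,4)] two_edges_apart[OF assms(1,3,5)]
    two_edges_apart[OF assms(2,3,6)]
  note facts = assms(4-6) d on_edgeD[OF assms(1)] on_edgeD[OF assms(2)] on_edgeD[OF assms(3)]
  have "c (k + 1) \<noteq> c (j + 1)" "\<not> E (c (k + 1)) (c (j + 1))" "\<not> E (c (k + 1)) (c (i + 1))"
    "\<not> E (c (j + 1)) (c (i + 1))" "\<not> E (c (k + 1)) (c (i + 2))" "\<not> E (c (j + 1)) (c (i + 2))"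
    using facts by (simp_all add: hole_adj hole_eq algebra_simps)
  moreover have "E (c (i + 1)) (c (i + 2))"
    using hole_next[of "i + 1"] by (simp add: algebra_simps)
  ultimately show False
    using no_fork[of z "c (k + 1)" "c (j + 1)" "c (i + 1)" "c (i + 2)"] facts by blast
qed

text \<open>An end of edge \<open>j\<close> is the second leaf beside \<open>p\<close> in forks at
  \<open>z\<close> whose branch leaves edge \<open>i\<close> along the hole, so \<open>p\<close>
  sees the next hole vertex on either side.\<close>

lemma neighbour_of_two_edges:
  assumes z: "on_edge z i" "on_edge z j" "\<not> n dvd j - i"
    and p: "off p" "E z p" "\<not> E p (c i)" "\<not> E p (c (i + 1))" "\<not> E p (c j)" "\<not> E p (c (j + 1))"
  shows "on_edge p (i + 2)" "on_edge p (i - 2)"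
proof -
  note d = two_edges_apart[OF z]
  note facts = d z(3) on_edgeD[OF z(1)] on_edgeD[OF z(2)] p
  have "E (c (i + 1)) (c (i + 2))" "E (c i) (c (i - 1))"
    "\<not> E (c (j + 1)) (c (i + 1))" "\<not> E (c (j + 1)) (c (i + 2))" "\<not> E (c j) (c i)" "\<not> E (c j) (c (i - 1))"
    using d z(3) by (simp_all add: hole_simps)
  note facts = facts this
  have "E p (c (i + 2))"
    using no_fork[of z p "c (j + 1)" "c (i + 1)" "c (i + 2)"] facts off_neq by blast
  then show "on_edge p (i + 2)"
    using ex_on_edge[of p "i + 2"] p on_edgeD(2)[of p "i + 1"] by (auto simp: algebra_simps)
  have "E p (c (i - 1))"
    using no_fork[of z p "c j" "c i" "c (i - 1)"] facts off_neq by blast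
  then show "on_edge p (i - 2)"
    using ex_on_edge[of p "i - 1"] p on_edgeD(3)[of p "i - 1"] by (auto simp: algebra_simps)
qed

text \<open>A neighbour of \<open>z\<close> missing both edges would itself sit on the two edges at distance two from
  either of them, which closes the hole up to length 8.\<close>

lemma no_claw_at_two_edges:
  assumes z: "on_edge z i" "on_edge z j" "\<not> n dvd j - i"
  shows "\<not> claw_at z p q r"
proof (rule not_claw_at_if_two_cliques)
  show "y \<in> edge_clique i \<or> y \<in> edge_clique j" if zy: "E z y" for y
  proof (cases "off y")
    case True
    show ?thesis
    proof (rule ccontr)
      assume "\<not> ?thesis"
      then have y: "\<not> E y (c i)" "\<not> E y (c (i + 1))" "\<not> E y (c j)" "\<not> E y (c (j + 1))"
        using neighbour_on_edge_iff[OF z(1) True zy] neighbour_on_edge_iff[OF z(2) True zy] True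
        unfolding edge_clique_def on_edge_def by auto
      have nij: "\<not> n dvd i - j" using z(3) by (simp add: dvd_diff_commute)
      note yi = neighbour_of_two_edges[OF z True zy y]
      note yj = neighbour_of_two_edges[OF z(2,1) nij True zy y(3,4,1,2)]
      \<comment> \<open>By \<open>at_most_two_edges\<close>, each of \<open>j + 2\<close>,
        \<open>j - 2\<close> repeats one of \<open>i + 2\<close>, \<open>i - 2\<close>; only the
        crosswise match is possible, and the two congruences differ by 8.\<close>
      have "n dvd (j + 2) - (i - 2)"
        using at_most_two_edges[OF yi yj(1)] z(3) not_dvd_small by (auto simp: algebra_simps)
      moreover have "n dvd (j - 2) - (i + 2)"
        using at_most_two_edges[OF yi yj(2)] z(3) not_dvd_small by (auto simp: algebra_simps)
      ultimately have "n dvd ((j + 2) - (i - 2)) - ((j - 2) - (i + 2))" by (rule dvd_diff)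
      then show False using not_dvd_8 by simp
    qed
  next
    case False
    then obtain k where k: "y = c k" unfolding off_def by blast
    then have "on_edge z k \<or> on_edge z (k - 1)"
      using ex_on_edge on_edgeD(1)[OF z(1)] zy by blast
    moreover have two: "n dvd k - i \<or> n dvd k - j" if "on_edge z k" for k
      using at_most_two_edges[OF z(1,2) that z(3)] by blast
    ultimately have "n dvd k - i \<or> n dvd k - j \<or> n dvd k - (i + 1) \<or> n dvd k - (j + 1)"
      using two[of k] two[of "k - 1"] by (auto simp: algebra_simps)
    then show ?thesis
      using k hole_eq unfolding edge_clique_def by blast
  qed
qed (fact edge_clique)+

lemma no_claw_at_touching:
  assumes z: "off z" "E z (c k)"
  shows "\<not> claw_at z p q r"
proof -
  obtain i where i: "on_edge z i" using ex_on_edge z by blast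
  show ?thesis
  proof (cases "edge z i")
    case True
    then show ?thesis using no_claw_at_edge z by blast
  next
    case False
    \<comment> \<open>The trace contains edge \<open>i\<close> but is not equal to it, so a further
      neighbour supplies a second edge.\<close>
    have "E z (c j)" if "n dvd j - i \<or> n dvd j - i - 1" for j
    proof -
      have "c j = c i \<or> c j = c (i + 1)" using that by (simp add: hole_eq algebra_simps)
      then show ?thesis using on_edgeD[OF i] by auto
    qed
    then obtain j where j: "E z (c j)" "\<not> n dvd j - i" "\<not> n dvd j - i - 1"
      using False unfolding edge_def by blast
    then have "on_edge z j \<or> on_edge z (j - 1)" using ex_on_edge z by blast
    then show ?thesis
      using no_claw_at_two_edges[OF i, of j] no_claw_at_two_edges[OF i, of "j - 1"] j
      by (auto simp: algebra_simps)
  qed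
qed

end

section \<open>Claws away from the hole\<close>

context far_odd_hole
begin

text \<open>This is the distance from the hole. It is finite everywhere, since the vertices
  reachable from the hole would otherwise form a homogeneous set.\<close>

lemma ex_distance:
  obtains d :: "'a \<Rightarrow> nat" where
    "\<And>v. v \<in> V \<Longrightarrow> d v = 0 \<longleftrightarrow> \<not> off v"
    "\<And>x y. E x y \<Longrightarrow> d y \<le> Suc (d x)"
    "\<And>v k. v \<in> V \<Longrightarrow> d v = Suc k \<Longrightarrow> \<exists>y. E v y \<and> d y = k"
proof -
  define R where "R = {(x, y). E x y}"
  define P where "P v k \<longleftrightarrow> (\<exists>i. (c i, v) \<in> R ^^ k)" for v k
  define d where "d v = (LEAST k. P v k)" for v
  define S where "S = {v. \<exists>k. P v k}"
  have c_S: "c i \<in> S" for i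
    unfolding S_def P_def by (metis (mono_tags) mem_Collect_eq relpow_0_I)
  have step: "P y (Suc k)" if "P x k" "E x y" for x y k
    using that unfolding P_def R_def by auto
  have closed: "y \<in> S" if "x \<in> S" "E x y" for x y
    using that step unfolding S_def by blast
  have S_V: "S \<subseteq> V"
  proof
    fix v assume "v \<in> S"
    then obtain k i where "(c i, v) \<in> R ^^ k" unfolding S_def P_def by blast
    then show "v \<in> V"
      using hole_next in_V by (cases k) (auto simp: R_def)
  qed
  have VS: "V = S"
  proof (rule ccontr)
    assume "V \<noteq> S"
    then have "card S < card V"
      using S_V finite_V by (intro psubset_card_mono) auto
    moreover have "card {c 0, c 1} \<le> card S"
      using c_S finite_subset[OF S_V finite_V] by (intro card_mono) auto
    then have "1 < card S"
      by (simp add: hole_eq not_dvd_small)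
    moreover have "\<not> E v s" if "v \<in> V - S" "s \<in> S" for v s
      using closed[of s v] that sym by blast
    ultimately have "homogeneous_set V E S"
      using S_V unfolding homogeneous_set_def by blast
    then show False using prime by blast
  qed
  have dP: "P v (d v)" if "v \<in> V" for v
  proof -
    have "\<exists>k. P v k" using that VS unfolding S_def by blast
    then show ?thesis unfolding d_def by (rule LeastI_ex)
  qed
  have dle: "d v \<le> k" if "P v k" for v k
    unfolding d_def using that by (rule Least_le)
  show thesis
  proof
    show "d v = 0 \<longleftrightarrow> \<not> off v" if "v \<in> V" for v
    proof
      assume "d v = 0"
      then show "\<not> off v" using dP[OF that] unfolding P_def off_def by auto
    next
      assume "\<not> off v"
      then have "P v 0" unfolding P_def off_def by auto
      then show "d v = 0" using dle by blast
    qed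
    show "d y \<le> Suc (d x)" if "E x y" for x y
      using dle step dP in_V that by blast
    show "\<exists>y. E v y \<and> d y = k" if v: "v \<in> V" "d v = Suc k" for v k
    proof -
      obtain i y where y: "(c i, y) \<in> R ^^ k" "E y v"
        using dP[OF v(1)] v(2) unfolding P_def R_def by auto
      then have "P y k" unfolding P_def by blast
      then have "d y \<le> k" by (rule dle)
      moreover have "d v \<le> Suc (d y)"
        using dle step dP in_V y by blast
      ultimately show ?thesis using y v sym by (metis Suc_le_mono le_antisym)
    qed
  qed
qed

text \<open>Forks at \<open>v\<close> with branch through \<open>p\<close> make \<open>q\<close> or
  \<open>r\<close> see each end of the edge of \<open>p\<close>. Neither can see both ends, being
  nonadjacent to \<open>p\<close>, so \<open>q\<close> and \<open>r\<close> lie on the two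
  consecutive edges, and a fork at \<open>v\<close> through one of them remains.\<close>

lemma no_claw_at_far_touching:
  assumes v: "far v" and claw: "claw_at v p q r" and p: "E p (c k)"
  shows False
proof -
  have pv: "E p v" "E q v" "E r v"
    using claw sym unfolding claw_at_def by blast+
  have off: "off p" "off q" "off r"
    using adj_far_off v pv by blast+
  obtain i where i: "on_edge p i" using ex_on_edge off p by blast
  note ep = edgeD[OF on_edge_edge[OF i v pv(1)]]
  have main: False
    if claw: "claw_at v p q r" and off: "off q" "off r" and qr: "E q v" "E r v"
      and q: "E q (c i)" and r: "E r (c (i + 1))" for q r
  proof -
    have nq: "\<not> on_edge q i" "\<not> on_edge r i"
      using on_edge_clique[OF i] claw unfolding claw_at_def by blast+
    have "on_edge q (i - 1)" using ex_on_edge[OF off(1) q] nq by blast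
    then have eq: "edge q (i - 1)" using on_edge_edge v qr by blast
    have "on_edge r (i + 1)" using ex_on_edge[OF off(2) r] nq by simp
    then have er: "edge r (i + 1)" using on_edge_edge v qr by blast
    show False
      by (rule no_fork[of v p r q "c (i - 1)"])
        (use claw sym[of r q] far_not_adj[OF v] in
          \<open>auto simp: claw_at_def hole_simps ep edgeD[OF eq] edgeD[OF er]\<close>)
  qed
  have *: "E q (c j) \<or> E r (c j)" if "E p (c j)" for j
    by (rule ccontr, rule no_fork[of v q r p "c j"])
      (use that claw sym[of q p] sym[of r p] far_not_adj[OF v] in \<open>auto simp: claw_at_def\<close>)
  have "\<not> on_edge q i" "\<not> on_edge r i"
    using on_edge_clique[OF i] claw unfolding claw_at_def by blast+
  then have "E q (c i) \<and> E r (c (i + 1)) \<or> E r (c i) \<and> E q (c (i + 1))"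
    using *[of i] *[of "i + 1"] on_edgeD[OF i] off unfolding on_edge_def by blast
  moreover have "claw_at v p r q"
    using claw claw_at_rotate claw_at_swap by blast
  ultimately show False
    using main[of q r] main[of r q] claw off pv by blast
qed

text \<open>Induction on the distance from the hole: a claw at distance at least two produces one
  with a centre nearer to the hole.\<close>

lemma no_claw:
  assumes "v \<in> V"
  shows "\<not> claw_at v p q r"
proof -
  obtain d where d0: "\<And>v. v \<in> V \<Longrightarrow> d v = (0::nat) \<longleftrightarrow> \<not> off v"
    and dE: "\<And>x y. E x y \<Longrightarrow> d y \<le> Suc (d x)"
    and dS: "\<And>v k. v \<in> V \<Longrightarrow> d v = Suc k \<Longrightarrow> \<exists>y. E v y \<and> d y = k"
    using ex_distance by metis
  have "\<forall>v\<in>V. d v = m \<longrightarrow> (\<forall>p q r. \<not> claw_at v p q r)" for m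
  proof (induction m rule: less_induct)
    case (less m)
    have IH: "\<not> claw_at w p q r" if "w \<in> V" "d w < m" for w p q r
      using less.IH that by blast
    show ?case
    proof (intro ballI impI allI notI)
      fix v p q r assume v: "v \<in> V" "d v = m" and claw: "claw_at v p q r"
      have "off v"
        using no_claw_at_hole claw unfolding off_def by blast
      moreover from this have "\<not> E v (c k)" for k
        using no_claw_at_touching claw by blast
      ultimately have far: "far v" using v unfolding far_def by blast
      have "m \<noteq> 0" using d0 v \<open>off v\<close> by blast
      moreover have "m \<noteq> 1"
      proof
        assume "m = 1"
        then obtain y where "E v y" "d y = 0" using dS[of v 0] v by auto
        then show False using d0[of y] in_V far unfolding far_def off_def by blast
      qed
      ultimately obtain k where m: "m = Suc (Suc k)"
        by (metis One_nat_def not0_implies_Suc)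
      have nb: "Suc k \<le> d y" if "E v y" for y
        using dE[of y v] sym[OF that] v m by simp
      have no2: "\<not> E v w" if "d w = k" for w
        using nb[of w] that by auto
      \<comment> \<open>If \<open>p\<close> is nearer than \<open>v\<close>, let \<open>w\<close> be
        the next vertex after it. A fork at \<open>v\<close> arises unless \<open>w\<close> sees
        another leaf, say \<open>q\<close>. Then either \<open>w\<close> is on the hole and
        \<open>no_claw_at_far_touching\<close> applies, or \<open>p\<close>, \<open>q\<close> and
        the next vertex \<open>w'\<close> form a claw at \<open>w\<close>.\<close>
      have near: False if claw: "claw_at v p q r" and p: "d p = Suc k" for p q r
      proof -
        have E: "E v p" "E v q" "E v r" using claw unfolding claw_at_def by blast+
        then obtain w where w: "E p w" "d w = k" using dS[of p k] p in_V by blast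
        have both: False
          if claw: "claw_at v p q r" and q: "E q w" for q r
        proof (cases k)
          case 0
          then obtain j where "w = c j" using d0[of w] w in_V unfolding off_def by blast
          then show False using no_claw_at_far_touching far claw w by blast
        next
          case (Suc l)
          have "E v q" using claw unfolding claw_at_def by blast
          then have dq: "Suc k \<le> d q" by (rule nb)
          obtain w' where w': "E w w'" "d w' = l" using dS[of w l] w in_V Suc by blast
          have "\<not> E p w'" "\<not> E q w'"
            using dE[of w' p] dE[of w' q] sym[of _ w'] dq p w' Suc by force+
          moreover from this have "p \<noteq> w'" "q \<noteq> w'"
            using p dq w' Suc by auto
          ultimately have "claw_at w p q w'"
            using claw w w' q sym unfolding claw_at_def by blast
          then show False using IH[of w] w in_V m by auto
        qed
        have "claw_at v p r q" using claw claw_at_rotate claw_at_swap by blast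
        then have "\<not> E q w" "\<not> E r w" using both claw by blast+
        then show False
          using no_fork[of v q r p w] claw w no2[of w] sym unfolding claw_at_def by metis
      qed
      have perms: "claw_at v q r p" "claw_at v r p q"
        using claw claw_at_rotate by blast+
      then have "d p \<noteq> Suc k" "d q \<noteq> Suc k" "d r \<noteq> Suc k"
        using near claw by blast+
      moreover have E: "E v p" "E v q" "E v r" using claw unfolding claw_at_def by blast+
      ultimately have dpqr: "m \<le> d p" "m \<le> d q" "m \<le> d r"
        using nb m by (metis Suc_leI le_neq_implies_less)+
      \<comment> \<open>No leaf is nearer than \<open>v\<close>, so the next vertex \<open>y\<close>
        towards the hole is not a leaf. By a fork with branch \<open>y\<close>, \<open>w\<close>, it
        sees one of any two leaves; by a claw at \<open>y\<close> with leaf \<open>w\<close>, it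
        does not see both. Three leaves make this impossible.\<close>
      obtain y where y: "E v y" "d y = Suc k" using dS[of v "Suc k"] v m by blast
      obtain w where w: "E y w" "d w = k" using dS[of y k] y in_V by blast
      have nw: "\<not> E s w" if "m \<le> d s" for s
        using dE[of w s] sym[of s w] that w m by auto
      have two: "E y s \<or> E y t" if "claw_at v s t u" "m \<le> d s" "m \<le> d t" for s t u
        by (rule ccontr, rule no_fork[of v s t y w])
          (use that y w nw no2[of w] sym[of _ y] in \<open>auto simp: claw_at_def\<close>)
      have one: "\<not> (E y s \<and> E y t)" if "claw_at v s t u" "m \<le> d s" "m \<le> d t" for s t u
      proof
        assume "E y s \<and> E y t"
        moreover have "s \<noteq> w" "t \<noteq> w" using that w m by auto
        ultimately have "claw_at y s t w"
          using that w nw unfolding claw_at_def by blast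
        then show False using IH[of y] y in_V m by auto
      qed
      show False
        using two[OF claw] two[OF perms(1)] two[OF perms(2)] one[OF claw] one[OF perms(1)]
          one[OF perms(2)] dpqr by blast
    qed
  qed
  then show ?thesis using assms by blast
qed

end

section \<open>Combining both halves\<close>

theorem theorem3p16:
  fixes V :: "'a set" and E :: "'a \<Rightarrow> 'a \<Rightarrow> bool"
  assumes "simple_graph V E"
    and "H_free fork_V fork_E V E"
    and "H_free cocricket_V cocricket_E V E"
  shows "H_free claw_V claw_E V E
         \<or> (\<exists>S. homogeneous_set V E S)
         \<or> (\<forall>u\<in>V. perfect (nonnbrs V E u) (induced_rel E (nonnbrs V E u)))"
proof -
  interpret fork_cocricket_free_graph V E
    by unfold_locales (fact assms)+
  have "perfect (nonnbrs V E u) (induced_rel E (nonnbrs V E u))"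
    if claw: "\<not> H_free claw_V claw_E V E" and prime: "\<nexists>S. homogeneous_set V E S" and u: "u \<in> V" for u
  proof (rule perfect_if_no_diamond_no_odd_hole)
    show "nonnbrs V E u \<subseteq> V" unfolding nonnbrs_def by blast
    \<comment> \<open>A missing edge would give a diamond in \<open>M(u)\<close> and, with
      \<open>u\<close> as isolated vertex, a co-cricket.\<close>
    show "E s t" if "x \<in> nonnbrs V E u" "y \<in> nonnbrs V E u" "s \<in> nonnbrs V E u" "t \<in> nonnbrs V E u"
      and "E x y" "E x s" "E x t" "E y s" "E y t" "s \<noteq> t" for x y s t
      using no_cocricket[of x y s t u] that u unfolding nonnbrs_def by blast
    show "\<nexists>c n. odd_hole E c n \<and> range c \<subseteq> nonnbrs V E u"
    proof (intro notI, elim exE conjE)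
      fix c n assume "odd_hole E c n" "range c \<subseteq> nonnbrs V E u"
      \<comment> \<open>Here \<open>u\<close> itself is the vertex \<open>a0\<close> anticomplete to
        the hole.\<close>
      then interpret far_odd_hole V E c n u
        using prime u by unfold_locales (auto simp: nonnbrs_def)
      obtain f where f: "inj_on f claw_V" "f ` claw_V \<subseteq> V"
        "\<forall>x\<in>claw_V. \<forall>y\<in>claw_V. E (f x) (f y) \<longleftrightarrow> claw_E x y"
        using claw unfolding H_free_def contains_induced_def by blast
      then have "claw_at (f 0) (f 1) (f 2) (f 3)"
        unfolding claw_at_def claw_V_def claw_E_def edges_rel_def inj_on_def
        by (simp add: doubleton_eq_iff)
      moreover have "f 0 \<in> V" using f(2) unfolding claw_V_def by blast
      ultimately show False using no_claw by blast
    qed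
  qed
  then show ?thesis by blast
qed

end
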